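(* Let $(X,\mathrm{d}_X,\mathfrak{m})$ be an $\mathrm{RCD}(0,N)$-space with $N\in(1,\infty)$, let $\mu=\rho\,\mathfrak{m}\in\mathcal{P}^1(X)$ with a measurable function $\rho\colon X\to[0,\infty)$ such that $\rho^{1/(\beta-N)}$ is concave on $\rho^{-1}((0,\infty))$ for some $\beta>N$, let $x_0\in X$ be a barycenter of $\mu$, and let $\gamma\colon\mathbb{R}\to X$ be a straight line with $\mathbf{b}_\gamma(x_0)=0$. Let $(Q,\mathfrak{q})$, $(X_q,\mathfrak{m}_q)$ and $\mu_q=\rho\,\mathfrak{m}_q=w_q\,dx$ be the elements of the localization associated with $\mathbf{b}_\gamma\rho$ (described in the context). Suppose that $$\mu(\{x\in X\mid\mathbf{b}_\gamma(x)\le0\})\le(1+\varepsilon)\Bigl(\frac{\beta}{\beta+1}\Bigr)^\beta$$ holds for some $\varepsilon>0$. Then, for each $\delta>0$, there exists $Q'\subset Q$ (with $\mu_q(X_q)>0$ for $q\in Q'$) such that $$\mu\Bigl(\bigcup_{q\in Q'}X_q\Bigr)\ge\frac{\delta}{1+\delta}$$ and every $q\in Q'$ satisfies $$\int_{\mathbb{R}}|R_q-F_q|\,dx\le\frac{4\sqrt3\,\beta^{\beta+1}}{(\beta+1)^\beta}(1+\varepsilon')\bigl(1-(1+\varepsilon')^{-1/\beta}\bigr)\Bigl(\frac{1}{\mu_q(X_q)}\int_{X_q}\mathbf{b}_\gamma^2\,d\mu_q\Bigr)^{1/2},$$ where $\varepsilon':=\varepsilon+\delta+\varepsilon\delta$,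 $c_q:=w_q(0)\big/\int_{-\infty}^0w_q(x)\,dx$, and $R_q$ and $F_q$ are the cumulative distribution functions of $\mu_q(X_q)^{-1}\mu_q$ and of the probability density $$c_q\Bigl(\frac{\beta}{\beta+1}\Bigr)^\beta\Bigl(1+\frac{c_q}{\beta}x\Bigr)^{\beta-1}\quad\text{on }\Bigl[-\frac{\beta}{c_q},\frac{1}{c_q}\Bigr],$$ respectively.
   Context: Metric notions. A (minimal) geodesic is a path $\eta\colon[0,1]\to X$ with $\mathrm{d}_X(\eta(s),\eta(t))=|s-t|\,\mathrm{d}_X(\eta(0),\eta(1))$. A function $f\colon X\to\mathbb{R}\cup\{-\infty\}$ is concave if $f(\eta(t))\ge(1-t)f(\eta(0))+tf(\eta(1))$ for all geodesics. "$\rho^{1/(\beta-N)}$ is concave on $\rho^{-1}((0,\infty))$" means that the function equal to $\rho^{1/(\beta-N)}$ where $\rho>0$ and $-\infty$ where $\rho=0$ is concave. A straight line is a map $\gamma\colon\mathbb{R}\to X$ with $\mathrm{d}_X(\gamma(s),\gamma(t))=|s-t|$; its Busemann function is $\mathbf{b}_\gamma(x):=\lim_{t\to\infty}\{t-\mathrm{d}_X(x,\gamma(t))\}$. $\mathcal{P}^p(X)$: Borel probability measures with finite $p$-th moment. A barycenter of $\mu\in\mathcal{P}^1(X)$ attains $\inf_{z\in X}\int_X\{\mathrm{d}_X^2(z,x)-\mathrm{d}_X^2(z_0,x)\}\,\mu(dx)$ ($z_0\in X$ arbitrary fixed). RCD-spaces. A metric measure space is a complete separable metric space with a Borel measure $\mathfrak{m}$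 with $\mathfrak{m}(U)\in(0,\infty)$ for every nonempty bounded open $U$. For $N\in(1,\infty)$ it is $\mathrm{CD}(0,N)$ if for any $\nu_0,\nu_1\in\mathcal{P}^2(X)$ absolutely continuous with respect to $\mathfrak{m}$ there is a $W_2$-geodesic $(\nu_\lambda)_{\lambda\in[0,1]}$ between them with $S_N(\nu_\lambda)\le(1-\lambda)S_N(\nu_0)+\lambda S_N(\nu_1)$ for all $\lambda$, where $S_N(\zeta\mathfrak{m}):=-\int_X\zeta^{(N-1)/N}d\mathfrak{m}$. It is $\mathrm{RCD}(0,N)$ if moreover it is infinitesimally Hilbertian ($W^{1,2}(X)$ is a Hilbert space). Localization (Cavalletti–Mondino needle decomposition for $f:=\mathbf{b}_\gamma\rho$, which satisfies $\int_Xf\,d\mathfrak{m}=0$). Put $\Omega:=\mathrm{supp}(\mu)$. It provides a set $Z\subset X$ with $f=0$ $\mathfrak{m}$-a.e. on $Z$ ($Z$ is $\mu$-negligible here), a measure space $(Q,\mathfrak{q})$, and a decomposition of $X\setminus Z$ into needles $\{X_q\}_{q\in Q}$, each the image of a minimal geodesic with the restricted distance, with a probability measure $\mathfrak{m}_q$ on $X_q$, such that: $\int_\Omega\phi\,d\mathfrak{m}=\int_Q\int_{X_q}\phi\,d\mathfrak{m}_q\,\mathfrak{q}(dq)$ for all $\phi\in L^1(\mathfrak{m})$ with $\mathrm{supp}(\phi)\subset\Omega$; and for $\mathfrak{q}$-a.e. $q$, $(X_q,\mathrm{d}_X,\mathfrak{m}_q)$ is $\mathrm{CD}(0,N)$ and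 $\int_{X_q}\mathbf{b}_\gamma\rho\,d\mathfrak{m}_q=0$. Put $\mu_q:=\rho\,\mathfrak{m}_q$. For $\mathfrak{q}$-a.e. $q$ with $\mu_q(X_q)>0$, $X_q$ is identified with $\mathbf{b}_\gamma(X_q)\subset\mathbb{R}$ via $\mathbf{b}_\gamma$, and $\mu_q=w_q\,dx$ is written through this identification (with $w_q=0$ outside $\mathbf{b}_\gamma(X_q)$, and $w_q^{1/(\beta-1)}$ concave on $w_q^{-1}((0,\infty))$). *)

theory Defs
  imports "HOL-Probability.Probability"
begin

definition minimal_geodesic :: "(real \<Rightarrow> 'a::metric_space) \<Rightarrow> bool" where
  "minimal_geodesic \<eta> \<longleftrightarrow>
     (\<forall>s\<in>{0..1}. \<forall>t\<in>{0..1}. dist (\<eta> s) (\<eta> t) = \<bar>s - t\<bar> * dist (\<eta> 0) (\<eta> 1))"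

text \<open>Intended for functions that avoid the value \<open>\<infinity>\<close>. Since \<open>0 * (-\<infinity>) = 0\<close> in \<open>ereal\<close>,
  the cases \<open>t = 0\<close> and \<open>t = 1\<close> impose nothing.\<close>

definition geodesically_concave :: "('a::metric_space \<Rightarrow> ereal) \<Rightarrow> bool" where
  "geodesically_concave f \<longleftrightarrow>
     (\<forall>\<eta> t. minimal_geodesic \<eta> \<longrightarrow> t \<in> {0..1} \<longrightarrow>
        ereal (1 - t) * f (\<eta> 0) + ereal t * f (\<eta> 1) \<le> f (\<eta> t))"

definition powr_concave_on_support :: "real \<Rightarrow> ('a::metric_space \<Rightarrow> real) \<Rightarrow> bool" where
  "powr_concave_on_support a g \<longleftrightarrow>
     geodesically_concave (\<lambda>x. if g x > 0 then ereal (g x powr a) else -\<infinity>)"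

definition straight_line :: "(real \<Rightarrow> 'a::metric_space) \<Rightarrow> bool" where
  "straight_line \<gamma> \<longleftrightarrow> (\<forall>s t. dist (\<gamma> s) (\<gamma> t) = \<bar>s - t\<bar>)"

definition busemann :: "(real \<Rightarrow> 'a::metric_space) \<Rightarrow> 'a \<Rightarrow> real" where
  "busemann \<gamma> x = Lim at_top (\<lambda>t. t - dist x (\<gamma> t))"

text \<open>Borel probability measures on a subset \<open>S\<close> of the ambient space are represented by Borel
  measures on the ambient space that are concentrated on \<open>S\<close>.\<close>

definition prob_moment :: "nat \<Rightarrow> 'a::metric_space set \<Rightarrow> 'a measure set" where
  "prob_moment p S =
     {\<nu>. sets \<nu> = sets borel \<and> prob_space \<nu> \<and> (AE x in \<nu>. x \<in> S) \<and>
         (\<exists>z. (\<integral>\<^sup>+x. ennreal (dist z x ^ p) \<partial>\<nu>) < \<infinity>)}"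

definition barycenter :: "'a::metric_space measure \<Rightarrow> 'a \<Rightarrow> bool" where
  "barycenter \<mu> x\<^sub>0 \<longleftrightarrow>
     (\<forall>z\<^sub>0 z. (LINT x|\<mu>. (dist x\<^sub>0 x)\<^sup>2 - (dist z\<^sub>0 x)\<^sup>2) \<le> (LINT x|\<mu>. (dist z x)\<^sup>2 - (dist z\<^sub>0 x)\<^sup>2))"

definition couplings :: "'a::metric_space measure \<Rightarrow> 'a measure \<Rightarrow> ('a \<times> 'a) measure set" where
  "couplings \<mu> \<nu> =
     {\<pi>. sets \<pi> = sets (borel \<Otimes>\<^sub>M borel) \<and> prob_space \<pi> \<and>
         distr \<pi> borel fst = \<mu> \<and> distr \<pi> borel snd = \<nu>}"

definition wasserstein2 :: "'a::metric_space measure \<Rightarrow> 'a measure \<Rightarrow> real" where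
  "wasserstein2 \<mu> \<nu> =
     sqrt (enn2real (INF \<pi>\<in>couplings \<mu> \<nu>. \<integral>\<^sup>+z. ennreal ((dist (fst z) (snd z))\<^sup>2) \<partial>\<pi>))"

definition wasserstein2_geodesic ::
    "'a::metric_space set \<Rightarrow> (real \<Rightarrow> 'a measure) \<Rightarrow> bool" where
  "wasserstein2_geodesic S \<nu> \<longleftrightarrow>
     (\<forall>t\<in>{0..1}. \<nu> t \<in> prob_moment 2 S) \<and>
     (\<forall>s\<in>{0..1}. \<forall>t\<in>{0..1}.
        wasserstein2 (\<nu> s) (\<nu> t) = \<bar>s - t\<bar> * wasserstein2 (\<nu> 0) (\<nu> 1))"

text \<open>The metric measure space \<open>(S, d, m)\<close> for a subset \<open>S\<close> of the ambient space, where again \<open>m\<close> is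
  a measure on the ambient space concentrated on \<open>S\<close>. Separability of \<open>S\<close> is inherited.\<close>

definition metric_measure_space :: "'a::polish_space set \<Rightarrow> 'a measure \<Rightarrow> bool" where
  "metric_measure_space S m \<longleftrightarrow>
     Topological_Spaces.complete S \<and> sets m = sets borel \<and> (AE x in m. x \<in> S) \<and>
     (\<forall>U. open U \<and> bounded (U \<inter> S) \<and> U \<inter> S \<noteq> {} \<longrightarrow>
        0 < emeasure m (U \<inter> S) \<and> emeasure m (U \<inter> S) < \<infinity>)"

text \<open>The density \<open>\<zeta>\<close> of the absolutely continuous part in the Lebesgue decomposition
  \<open>\<nu> = \<zeta> m + \<sigma>\<close>; it is determined \<open>m\<close>-almost everywhere.\<close>

definition ac_density :: "'a measure \<Rightarrow> 'a measure \<Rightarrow> 'a \<Rightarrow> real" where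
  "ac_density m \<nu> =
     (SOME \<zeta>. \<zeta> \<in> borel_measurable m \<and> (\<forall>x. 0 \<le> \<zeta> x) \<and>
        (\<exists>\<sigma>. sets \<sigma> = sets m \<and> (\<exists>B\<in>null_sets m. emeasure \<sigma> (space m - B) = 0) \<and>
           (\<forall>A\<in>sets m. emeasure \<nu> A =
              emeasure (density m (\<lambda>x. ennreal (\<zeta> x))) A + emeasure \<sigma> A)))"

text \<open>For \<open>\<nu> = \<zeta> m\<close> this is \<open>- \<integral> \<zeta> powr ((N - 1) / N) dm\<close>, which may be \<open>-\<infinity>\<close> when \<open>m\<close> is infinite.
  Measures with a singular part get the usual extension that ignores it.\<close>

definition renyi_entropy :: "real \<Rightarrow> 'a measure \<Rightarrow> 'a measure \<Rightarrow> ereal" where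
  "renyi_entropy N m \<nu> =
     - enn2ereal (\<integral>\<^sup>+x. ennreal (ac_density m \<nu> x powr ((N - 1) / N)) \<partial>m)"

definition CD0_space :: "real \<Rightarrow> 'a::polish_space set \<Rightarrow> 'a measure \<Rightarrow> bool" where
  "CD0_space N S m \<longleftrightarrow>
     metric_measure_space S m \<and>
     (\<forall>\<nu>\<^sub>0\<in>prob_moment 2 S. \<forall>\<nu>\<^sub>1\<in>prob_moment 2 S.
        absolutely_continuous m \<nu>\<^sub>0 \<and> absolutely_continuous m \<nu>\<^sub>1 \<longrightarrow>
        (\<exists>\<nu>. wasserstein2_geodesic S \<nu> \<and> \<nu> 0 = \<nu>\<^sub>0 \<and> \<nu> 1 = \<nu>\<^sub>1 \<and>
           (\<forall>t\<in>{0..1}. renyi_entropy N m (\<nu> t)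
              \<le> ereal (1 - t) * renyi_entropy N m \<nu>\<^sub>0 + ereal t * renyi_entropy N m \<nu>\<^sub>1)))"

text \<open>The limes superior is \<open>0\<close> at isolated points, where \<open>at x\<close> is the trivial filter.\<close>

definition local_lip :: "('a::metric_space \<Rightarrow> real) \<Rightarrow> 'a \<Rightarrow> ennreal" where
  "local_lip f x = Limsup (at x) (\<lambda>y. ennreal (\<bar>f y - f x\<bar> / dist y x))"

definition square_integrable :: "'a measure \<Rightarrow> ('a \<Rightarrow> real) \<Rightarrow> bool" where
  "square_integrable m f \<longleftrightarrow> f \<in> borel_measurable m \<and> integrable m (\<lambda>x. (f x)\<^sup>2)"

text \<open>Cheeger energy: the lower semicontinuous relaxation in \<open>L\<^sup>2(m)\<close> of
  \<open>f \<mapsto> (1/2) \<integral> (local_lip f)\<^sup>2 dm\<close> on square integrable Lipschitz functions.\<close>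

definition cheeger_energy :: "'a::metric_space measure \<Rightarrow> ('a \<Rightarrow> real) \<Rightarrow> ennreal" where
  "cheeger_energy m f =
     (INF F \<in> {F :: nat \<Rightarrow> 'a \<Rightarrow> real.
          (\<forall>n. (\<exists>L. L-lipschitz_on UNIV (F n)) \<and> square_integrable m (F n)) \<and>
          (\<lambda>n. \<integral>\<^sup>+x. ennreal ((F n x - f x)\<^sup>2) \<partial>m) \<longlonglongrightarrow> 0}.
        liminf (\<lambda>n. (\<integral>\<^sup>+x. (local_lip (F n) x)\<^sup>2 \<partial>m) / 2))"

definition sobolev :: "'a::metric_space measure \<Rightarrow> ('a \<Rightarrow> real) set" where
  "sobolev m = {f. square_integrable m f \<and> cheeger_energy m f < \<infinity>}"

definition sobolev_norm :: "'a::metric_space measure \<Rightarrow> ('a \<Rightarrow> real) \<Rightarrow> real" where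
  "sobolev_norm m f = sqrt ((LINT x|m. (f x)\<^sup>2) + 2 * enn2real (cheeger_energy m f))"

text \<open>The Sobolev space is a Hilbert space: its norm is induced by an inner product and is complete.
  Functions agreeing \<open>m\<close>-almost everywhere need not be identified explicitly, as the form \<open>B\<close> is
  then invariant under such changes by the Cauchy--Schwarz inequality.\<close>

definition infinitesimally_hilbertian :: "'a::metric_space measure \<Rightarrow> bool" where
  "infinitesimally_hilbertian m \<longleftrightarrow>
     (\<exists>B :: ('a \<Rightarrow> real) \<Rightarrow> ('a \<Rightarrow> real) \<Rightarrow> real.
        (\<forall>f\<in>sobolev m. \<forall>g\<in>sobolev m. B f g = B g f) \<and>
        (\<forall>f\<in>sobolev m. \<forall>g\<in>sobolev m. \<forall>h\<in>sobolev m.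
           B (\<lambda>x. f x + g x) h = B f h + B g h) \<and>
        (\<forall>c. \<forall>f\<in>sobolev m. \<forall>h\<in>sobolev m. B (\<lambda>x. c * f x) h = c * B f h) \<and>
        (\<forall>f\<in>sobolev m. B f f = (sobolev_norm m f)\<^sup>2)) \<and>
     (\<forall>u :: nat \<Rightarrow> 'a \<Rightarrow> real.
        (\<forall>n. u n \<in> sobolev m) \<and>
        (\<forall>e>0. \<exists>n\<^sub>0. \<forall>i\<ge>n\<^sub>0. \<forall>j\<ge>n\<^sub>0. sobolev_norm m (\<lambda>x. u i x - u j x) < e) \<longrightarrow>
        (\<exists>v\<in>sobolev m. (\<lambda>n. sobolev_norm m (\<lambda>x. u n x - v x)) \<longlonglongrightarrow> 0))"

definition RCD0_space :: "real \<Rightarrow> 'a::polish_space measure \<Rightarrow> bool" where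
  "RCD0_space N m \<longleftrightarrow> CD0_space N UNIV m \<and> infinitesimally_hilbertian m"

definition measure_support :: "'a::topological_space measure \<Rightarrow> 'a set" where
  "measure_support \<nu> = {x. \<forall>U. open U \<and> x \<in> U \<longrightarrow> 0 < emeasure \<nu> U}"

text \<open>The support of an element of \<open>L\<^sup>1(m)\<close>, independent of the representative.\<close>

definition L1_support :: "'a::topological_space measure \<Rightarrow> ('a \<Rightarrow> real) \<Rightarrow> 'a set" where
  "L1_support m \<phi> = measure_support (density m (\<lambda>x. ennreal \<bar>\<phi> x\<bar>))"

abbreviation weighted :: "('a \<Rightarrow> real) \<Rightarrow> 'a measure \<Rightarrow> 'a measure" where
  "weighted \<rho> m \<equiv> density m (\<lambda>x. ennreal (\<rho> x))"

text \<open>A localization of \<open>f = busemann \<gamma> * \<rho>\<close>. The set \<open>Q\<close> with its measure \<open>\<qq>\<close> is the measure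
  space \<open>\<qq>\<close>; the needle over \<open>q\<close> is \<open>X q\<close>, and \<open>mq q\<close> is its probability measure, viewed as a Borel
  measure on the ambient space. Identifying \<open>X q\<close> with its image under the Busemann function \<open>b\<close>
  turns \<open>\<mu>\<^sub>q\<close> into its image measure under \<open>b\<close>, with density \<open>w q\<close>.

  The condition on unions \<open>\<Union>q\<in>A. X q\<close> says that the quotient map from the complement of \<open>Z\<close> to \<open>Q\<close>, which sends \<open>X q\<close>
  to \<open>q\<close>, is measurable for the completion of \<open>m\<close>. The set \<open>Z\<close> itself need not be Borel.\<close>

definition localization ::
    "'a::polish_space measure \<Rightarrow> ('a \<Rightarrow> real) \<Rightarrow> (real \<Rightarrow> 'a) \<Rightarrow> real \<Rightarrow> real \<Rightarrow>
     'a set \<Rightarrow> 'q measure \<Rightarrow> ('q \<Rightarrow> 'a set) \<Rightarrow> ('q \<Rightarrow> 'a measure) \<Rightarrow> ('q \<Rightarrow> real \<Rightarrow> real) \<Rightarrow> bool" where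
  "localization m \<rho> \<gamma> N \<beta> Z \<qq> X mq w \<longleftrightarrow>
     (let b = busemann \<gamma>; \<mu> = weighted \<rho> m; \<Omega> = measure_support \<mu> in
     (AE x in m. x \<in> Z \<longrightarrow> b x * \<rho> x = 0) \<and> (AE x in \<mu>. x \<notin> Z) \<and>
     disjoint_family_on X (space \<qq>) \<and> (\<Union>q\<in>space \<qq>. X q) = - Z \<and>
     (\<forall>A\<in>sets \<qq>. (\<Union>q\<in>A. X q) \<in> sets (completion m)) \<and>
     (\<forall>q\<in>space \<qq>. \<exists>\<eta>. minimal_geodesic \<eta> \<and> X q = \<eta> ` {0..1}) \<and>
     (\<forall>q\<in>space \<qq>. sets (mq q) = sets borel \<and> prob_space (mq q) \<and> (AE x in mq q. x \<in> X q)) \<and>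
     (\<forall>\<phi>. integrable m \<phi> \<and> L1_support m \<phi> \<subseteq> \<Omega> \<longrightarrow>
        (AE q in \<qq>. set_integrable (mq q) (X q) \<phi>) \<and>
        integrable \<qq> (\<lambda>q. LINT x:X q|mq q. \<phi> x) \<and>
        (LINT x:\<Omega>|m. \<phi> x) = (LINT q|\<qq>. (LINT x:X q|mq q. \<phi> x))) \<and>
     (AE q in \<qq>. CD0_space N (X q) (mq q) \<and> (LINT x:X q|mq q. b x * \<rho> x) = 0) \<and>
     (AE q in \<qq>. 0 < emeasure (weighted \<rho> (mq q)) (X q) \<longrightarrow>
        inj_on b (X q) \<and>
        w q \<in> borel_measurable borel \<and> (\<forall>x. 0 \<le> w q x) \<and> (\<forall>x. x \<notin> b ` X q \<longrightarrow> w q x = 0) \<and>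
        distr (weighted \<rho> (mq q)) borel b = density lborel (\<lambda>x. ennreal (w q x)) \<and>
        powr_concave_on_support (1 / (\<beta> - 1)) (w q)))"

definition model_rate :: "(real \<Rightarrow> real) \<Rightarrow> real" where
  "model_rate w = w 0 / (LINT x:{..0}|lborel. w x)"

definition model_measure :: "real \<Rightarrow> real \<Rightarrow> real measure" where
  "model_measure \<beta> c = density lborel (\<lambda>x. ennreal
     (c * (\<beta> / (\<beta> + 1)) powr \<beta> * (1 + c / \<beta> * x) powr (\<beta> - 1) * indicator {- \<beta> / c..1 / c} x))"

text \<open>The image under \<open>b\<close> of \<open>\<nu>\<close> normalized by its mass on \<open>S\<close>; its \<open>cdf\<close> is \<open>R\<^sub>q\<close> for \<open>\<nu> = \<mu>\<^sub>q\<close>, \<open>S = X q\<close>.\<close>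

definition normalized_image :: "('a \<Rightarrow> real) \<Rightarrow> 'a measure \<Rightarrow> 'a set \<Rightarrow> real measure" where
  "normalized_image b \<nu> S = scale_measure (1 / emeasure \<nu> S) (distr \<nu> borel b)"

end

theory Submission
  imports Defs "HOL-Real_Asymp.Real_Asymp"
begin

text \<open>By Markov's inequality applied to the disintegration, needles of total mass at least
  \<open>\<delta> / (1 + \<delta>)\<close> satisfy the almost equality with \<open>1 + \<epsilon>' = (1 + \<epsilon>) * (1 + \<delta>)\<close>, which reduces the claim to
  densities \<open>u\<close> on the line. There the distribution function satisfies
  \<open>R x \<le> R 0 * (1 + c / \<beta> * x) powr \<beta>\<close>, and the right hand side is at most \<open>1 + \<epsilon>'\<close> times the
  formula for \<open>F\<close>; so \<open>R\<close> lies below the minimum of this and \<open>1\<close>. As \<open>R\<close> and \<open>F\<close> are both centred, their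
  distance is at most \<open>2 * \<beta> / c * (1 - (1 + \<epsilon>') powr (- 1 / \<beta>))\<close>. Finally
  \<open>1 / c = R 0 / u 0\<close> is bounded through \<open>12 * (u 0)\<^sup>2 * Var \<ge> 1\<close>, valid for every log-concave density
  centred at \<open>0\<close>; the extremal densities are truncated exponentials.\<close>

section \<open>The second moment of a centred density\<close>

text \<open>Everything rests on centring. The needles come from the Busemann function times
  \<open>\<rho>\<close>, so the zero-integral condition on a needle says that its measure has mean 0
  in the Busemann coordinate. The integral of a distribution function over a long interval [-L, L]
  is L minus the mean; hence \<open>R\<close> and \<open>F\<close> have equal integrals, and an
  upper bound on \<open>R\<close> alone controls the whole distance. The bounding function
  \<open>R 0 * (1 + c / \<beta> * x) powr \<beta>\<close> agrees with \<open>R\<close> at 0 in value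
  and in slope, which fixes the rate \<open>c\<close>.

  The number 12 belongs to the uniform density of height \<open>u0\<close>: it lives on an interval
  of length 1/u0 and has variance 1/(12 u0^2). Log-concavity enters the variance bound only through
  a single majorant \<open>u0 * exp (p * x)\<close>, given by a supporting line at 0. Minimizing the
  second moment below this majorant, at mass 1 and mean 0, yields a one-parameter family of
  truncated exponentials. The bound for this family is an inequality between hyperbolic functions,
  with equality in the untilted limit.\<close>

lemma sinh_le_mult_cosh: "0 \<le> y * cosh y - sinh y" if "0 \<le> (y::real)"
proof -
  have "(\<lambda>y. y * cosh y - sinh y) 0 \<le> (\<lambda>y. y * cosh y - sinh y) y"
    by (rule DERIV_nonneg_imp_nondecreasing[OF that])
      (rule exI, rule conjI, (rule derivative_eq_intros | simp)+)
  then show ?thesis by simp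
qed

lemma cosh_le_mult_sinh: "0 \<le> 1/2 - cosh y / 2 + y * sinh y / 4" if "0 \<le> (y::real)"
proof -
  have "(\<lambda>y. 1/2 - cosh y / 2 + y * sinh y / 4) 0 \<le> (\<lambda>y. 1/2 - cosh y / 2 + y * sinh y / 4) y"
    apply (rule DERIV_nonneg_imp_nondecreasing[OF that])
    subgoal for x
      apply (rule exI[of _ "(x * cosh x - sinh x) / 4"])
      using sinh_le_mult_cosh[of x] by (auto intro!: derivative_eq_intros simp: field_simps)
    done
  then show ?thesis by simp
qed

lemma sinh_le_mult_cosh_quarter: "0 \<le> (sinh y + y * cosh y) / 4 + y / 2 - sinh y" if "0 \<le> (y::real)"
proof -
  have "(\<lambda>y. (sinh y + y * cosh y) / 4 + y / 2 - sinh y) 0 \<le> (\<lambda>y. (sinh y + y * cosh y) / 4 + y / 2 - sinh y) y"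
    apply (rule DERIV_nonneg_imp_nondecreasing[OF that])
    subgoal for x
      apply (rule exI[of _ "1/2 - cosh x / 2 + x * sinh x / 4"])
      using cosh_le_mult_sinh[of x] by (auto intro!: derivative_eq_intros simp: field_simps)
    done
  then show ?thesis by simp
qed

text \<open>The difference of the two sides vanishes at 0 together with its first three derivatives,
  and its fourth derivative is \<open>y * sinh y / 4\<close>. The three preceding lemmas give the
  signs of the third, second and first derivative, the third up to a factor 4.\<close>

lemma cosh_le_mult_sinh_quadratic: "cosh y - 1 \<le> y * sinh y / 4 + y\<^sup>2 / 4" if "0 \<le> (y::real)"
proof -
  have "(\<lambda>y. y * sinh y / 4 + y\<^sup>2 / 4 - cosh y + 1) 0 \<le> (\<lambda>y. y * sinh y / 4 + y\<^sup>2 / 4 - cosh y + 1) y"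
    apply (rule DERIV_nonneg_imp_nondecreasing[OF that])
    subgoal for x
      apply (rule exI[of _ "(sinh x + x * cosh x) / 4 + x / 2 - sinh x"])
      using sinh_le_mult_cosh_quarter[of x] by (auto intro!: derivative_eq_intros simp: field_simps)
    done
  then show ?thesis by simp
qed

text \<open>The doubling formulas turn the previous bound at \<open>y = 2 * z\<close> into the sign
  of the numerator that arises when \<open>D\<close> of the truncated exponential inequality is
  differentiated.\<close>

lemma sinh_cosh_ge: "2 * (sinh z)\<^sup>2 \<le> z * (sinh z * cosh z) + z\<^sup>2" if "0 \<le> (z::real)"
proof -
  have "cosh (2 * z) - 1 = 2 * (sinh z)\<^sup>2"
    unfolding cosh_double using cosh_square_eq[of z] by simp
  then show ?thesis
    using cosh_le_mult_sinh_quadratic[of "2 * z"] that unfolding sinh_double by (simp add: power2_eq_square)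
qed

lemma sinh_gt_self: "z < sinh z" if "0 < (z::real)"
proof -
  have "(\<lambda>y. sinh y - y) 0 < (\<lambda>y. sinh y - y) z"
    apply (rule DERIV_pos_imp_increasing_open[OF that])
    subgoal for x
      apply (rule exI[of _ "cosh x - 1"])
      using cosh_real_ge_1[of x] cosh_real_strict_mono[of 0 x]
      by (auto intro!: derivative_eq_intros)
    by (intro continuous_intros)
  then show ?thesis by simp
qed

text \<open>\<open>D\<close> is the logarithm of the ratio of the two sides of the inequality wanted
  for truncated exponentials. It increases from the limit 0 at the origin: there (sinh z)^2 - z^2
  behaves like z^4/3, which is where the factor 3 comes from and why it is sharp.\<close>

lemma truncated_exponential_log_ineq:
  fixes z :: real
  assumes z: "0 < z"
  defines "D \<equiv> \<lambda>z::real. 2 * (z * cosh z / sinh z - 1) + ln (sinh z ^ 2 - z ^ 2) + ln 3 - 4 * ln (sinh z)"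
  shows "0 \<le> D z"
proof -
  have lim: "(D \<longlongrightarrow> 0) (at_right 0)"
    unfolding D_def by real_asymp (simp add: ln_div)
  have deriv: "\<exists>y. (D has_real_derivative y) (at x) \<and> 0 \<le> y" if x: "0 < x" for x :: real
  proof (intro exI conjI)
    have s: "0 < sinh x" and sq: "0 < (sinh x)\<^sup>2 - x\<^sup>2"
      using x sinh_gt_self[OF x] power_strict_mono[of x "sinh x" 2] by auto
    let ?s = "sinh x" and ?c = "cosh x"
    let ?D = "2 * (?c / ?s - x / ?s\<^sup>2) + (2 * ?s * ?c - 2 * x) / (?s\<^sup>2 - x\<^sup>2) - 4 * ?c / ?s"
    have "(x * ?s + ?c) * ?s - x * ?c * ?c = ?c * ?s - x" 
      using cosh_square_eq[of x] by (simp add: power2_eq_square algebra_simps)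
    then have 1: "((\<lambda>z. z * cosh z / sinh z) has_real_derivative ?c / ?s - x / ?s\<^sup>2) (at x)"
      using s by (auto intro!: derivative_eq_intros simp: divide_simps power2_eq_square) (simp add: algebra_simps)
    have 2: "((\<lambda>z. ln ((sinh z)\<^sup>2 - z\<^sup>2)) has_real_derivative (2 * ?s * ?c - 2 * x) / (?s\<^sup>2 - x\<^sup>2)) (at x)"
      using sq by (auto intro!: derivative_eq_intros simp: power2_eq_square divide_simps)
    have 3: "((\<lambda>z. ln (sinh z)) has_real_derivative ?c / ?s) (at x)"
      using s by (auto intro!: derivative_eq_intros)
    show "(D has_real_derivative ?D) (at x)"
      unfolding D_def
      using DERIV_diff[OF DERIV_add[OF DERIV_add[OF DERIV_cmult[OF DERIV_diff[OF 1 DERIV_const]] 2]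
        DERIV_const] DERIV_cmult[OF 3], of 2 1 "ln 3" 4]
      by simp
    have "?D = 2 * x * (x * (?s * ?c) + x\<^sup>2 - 2 * ?s\<^sup>2) / (?s\<^sup>2 * (?s\<^sup>2 - x\<^sup>2))"
      using s sq sinh_gt_self[OF x] by (simp add: divide_simps) (simp add: algebra_simps power2_eq_square)
    also have "\<dots> \<ge> 0"
      using sinh_cosh_ge[of x] x s sq by (auto intro!: divide_nonneg_pos mult_nonneg_nonneg mult_pos_pos)
    finally show "0 \<le> ?D" .
  qed
  have mono: "D y \<le> D z" if "0 < y" "y \<le> z" for y
    using that by (intro DERIV_nonneg_imp_nondecreasing[of y z D]) (auto intro: deriv)
  have "\<forall>\<^sub>F y in at_right 0. D y \<le> D z"
    unfolding eventually_at_right_field using mono z by (intro exI[of _ z]) auto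
  then show ?thesis
    using tendsto_upperbound[OF lim] by simp
qed

lemma truncated_exponential_ineq:
  fixes z :: real
  assumes z: "0 < z"
  shows "sinh z ^ 4 \<le> 3 * exp (2 * (z * cosh z / sinh z - 1)) * ((sinh z)\<^sup>2 - z\<^sup>2)"
proof -
  have s: "0 < sinh z" and sq: "0 < (sinh z)\<^sup>2 - z\<^sup>2"
    using z sinh_gt_self[OF z] power_strict_mono[of z "sinh z" 2] by auto
  have "ln (sinh z ^ 4) \<le> ln (3 * exp (2 * (z * cosh z / sinh z - 1)) * ((sinh z)\<^sup>2 - z\<^sup>2))"
    using truncated_exponential_log_ineq[OF z] s sq sinh_gt_self[OF z] by (simp add: ln_mult ln_realpow)
  then show ?thesis
    using s sq by (subst (asm) ln_le_cancel_iff) auto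
qed

text \<open>With \<open>r = p / u0\<close> the equation is the mass normalization of
  \<open>u0 * exp (p * x)\<close> on the interval of half-length \<open>z / p\<close> whose centre
  makes the mean 0. The right hand side tends to 0 at the origin and to \<open>exp 1\<close> at
  infinity, so the intermediate value theorem reaches every \<open>r\<close> in between.\<close>

lemma tilt_surjective:
  assumes r: "0 < r" "r < exp (1::real)"
  obtains z where "0 < z" "r = 2 * sinh z * exp (1 - z * cosh z / sinh z)"
proof -
  let ?f = "\<lambda>z::real. 2 * sinh z * exp (1 - z * cosh z / sinh z)"
  have "(?f \<longlongrightarrow> 0) (at_right 0)"
    by real_asymp
  from order_tendstoD(2)[OF this r(1)] obtain a where a: "0 < a" "?f a < r"
    unfolding eventually_at_right_field by (meson dense)
  have "(?f \<longlongrightarrow> exp 1) at_top"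
    by real_asymp
  from order_tendstoD(1)[OF this r(2)] obtain b where b: "a \<le> b" "r < ?f b"
    unfolding eventually_at_top_linorder by (meson le_cases order_refl)
  have "\<exists>z\<ge>a. z \<le> b \<and> ?f z = r"
    using a b by (intro IVT') (auto intro!: continuous_intros)
  then show ?thesis
    using a that by (metis less_le_trans)
qed

section \<open>Minimal second moment of a centred density below an exponential\<close>

locale centred_density =
  fixes u :: "real \<Rightarrow> real" and K :: real
  assumes measurable_u [measurable]: "u \<in> borel_measurable borel"
    and nonneg: "0 \<le> u x"
    and outside: "x \<notin> {-K..K} \<Longrightarrow> u x = 0"
    and integrable_u: "integrable lborel u"
    and integral_u: "(LINT x|lborel. u x) = 1"
    and mean_zero: "(LINT x|lborel. x * u x) = 0"
begin

lemma K_pos: "0 < K"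
proof (rule ccontr)
  assume "\<not> 0 < K"
  then have "{x. u x \<noteq> 0} \<subseteq> {0}"
    using outside by (force simp: not_less)
  then have "AE x in lborel. u x = 0"
    by (intro AE_I[of _ _ "{0}"]) auto
  then have "(LINT x|lborel. u x) = 0"
    by (rule integral_eq_zero_AE)
  then show False
    using integral_u by simp
qed

text \<open>On the bounded support a continuous weight is bounded, so all moments exist.\<close>

lemma integrable_mult:
  assumes "continuous_on {-K..K} f" "f \<in> borel_measurable borel"
  shows "integrable lborel (\<lambda>x. f x * u x)"
proof -
  obtain B where B: "\<And>x. x \<in> {-K..K} \<Longrightarrow> \<bar>f x\<bar> \<le> B"
    using compact_imp_bounded[OF compact_continuous_image[OF assms(1) compact_Icc]]
    unfolding bounded_iff by (metis imageI real_norm_def)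
  show ?thesis
  proof (rule Bochner_Integration.integrable_bound)
    show "integrable lborel (\<lambda>x. B * u x)"
      using integrable_u by simp
    show "AE x in lborel. norm (f x * u x) \<le> norm (B * u x)"
    proof (intro AE_I2)
      fix x
      show "norm (f x * u x) \<le> norm (B * u x)"
      proof (cases "x \<in> {-K..K}")
        case True
        then have "\<bar>f x\<bar> \<le> \<bar>B\<bar>" using B[of x] by linarith
        then show ?thesis using nonneg[of x] by (simp add: abs_mult mult_right_mono)
      next
        case False
        then show ?thesis using outside[of x] by simp
      qed
    qed
  qed (use assms(2) in simp)
qed

lemma integrable_moment: "integrable lborel (\<lambda>x. x ^ n * u x)"
  by (intro integrable_mult) (auto intro!: continuous_intros)

lemma integrable_first_moment: "integrable lborel (\<lambda>x. x * u x)"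
  using integrable_moment[of 1] by simp

lemma reflect: "centred_density (\<lambda>x. u (- x)) K"
proof
  show "integrable lborel (\<lambda>x. u (- x))"
    using lborel_integrable_real_affine[OF integrable_u, of "-1" 0] by simp
  show "(LINT x|lborel. u (- x)) = 1"
    using lborel_integral_real_affine[of "-1" u 0] integral_u by simp
  show "(LINT x|lborel. x * u (- x)) = 0"
    using lborel_integral_real_affine[of "-1" "\<lambda>x. x * u x" 0] mean_zero by simp
qed (use nonneg outside in auto)

lemma integral_affine: "(LINT x|lborel. (a * x + b) * u x) = b"
proof -
  have "(LINT x|lborel. (a * x + b) * u x) = (LINT x|lborel. a * (x * u x) + b * u x)"
    by (simp add: algebra_simps)
  also have "\<dots> = a * (LINT x|lborel. x * u x) + b * (LINT x|lborel. u x)"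
    using integrable_first_moment integrable_u by simp
  finally show ?thesis
    by (simp add: mean_zero integral_u)
qed

lemma integral_quadratic:
  "(LINT x|lborel. ((x - m)\<^sup>2 - d) * u x) = (LINT x|lborel. x\<^sup>2 * u x) + m\<^sup>2 - d"
proof -
  have "(LINT x|lborel. ((x - m)\<^sup>2 - d) * u x) = (LINT x|lborel. x\<^sup>2 * u x + (- 2 * m * x + (m\<^sup>2 - d)) * u x)"
    by (simp add: power2_eq_square algebra_simps)
  also have "\<dots> = (LINT x|lborel. x\<^sup>2 * u x) + (LINT x|lborel. (- 2 * m * x + (m\<^sup>2 - d)) * u x)"
    by (intro Bochner_Integration.integral_add integrable_moment integrable_mult) (auto intro!: continuous_intros)
  finally show ?thesis
    unfolding integral_affine by simp
qed

text \<open>Linear programming duality: among the densities below \<open>U\<close>, the second moment is smallest for \<open>U\<close>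
  restricted to an interval, and the dual certificate is the quadratic vanishing at its end points.\<close>

lemma second_moment_ge:
  assumes U: "\<And>x. x \<in> {m - L..m + L} \<Longrightarrow> u x \<le> U x" and "0 \<le> L"
    and F: "\<And>x. x \<in> {m - L..m + L} \<Longrightarrow> (F has_real_derivative ((x - m)\<^sup>2 - L\<^sup>2) * U x) (at x)"
    and cont: "continuous_on UNIV U"
  shows "F (m + L) - F (m - L) + L\<^sup>2 - m\<^sup>2 \<le> (LINT x|lborel. x\<^sup>2 * u x)"
proof -
  have hb: "has_bochner_integral lborel (\<lambda>x. (((x - m)\<^sup>2 - L\<^sup>2) * U x) * indicator {m - L..m + L} x) (F (m + L) - F (m - L))"
    using assms(2) F cont
    by (intro has_bochner_integral_FTC_Icc_real)
       (auto intro!: continuous_intros simp: continuous_on_eq_continuous_within)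
  have "F (m + L) - F (m - L) = (LINT x|lborel. (((x - m)\<^sup>2 - L\<^sup>2) * U x) * indicator {m - L..m + L} x)"
    using hb by (simp add: has_bochner_integral_integral_eq)
  also have "\<dots> \<le> (LINT x|lborel. ((x - m)\<^sup>2 - L\<^sup>2) * u x)"
  proof (intro integral_mono)
    show "integrable lborel (\<lambda>x. (((x - m)\<^sup>2 - L\<^sup>2) * U x) * indicator {m - L..m + L} x)"
      using hb by (simp add: has_bochner_integral_iff)
    show "integrable lborel (\<lambda>x. ((x - m)\<^sup>2 - L\<^sup>2) * u x)"
      by (intro integrable_mult) (auto intro!: continuous_intros)
    fix x
    \<comment> \<open>The sign of the quadratic decides how \<open>u\<close> may be replaced: where
      it is nonpositive, raising \<open>u\<close> to \<open>U\<close> lowers the product; where it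
      is positive, dropping \<open>u\<close> to 0 does.\<close>
    have iff: "(x - m)\<^sup>2 - L\<^sup>2 \<le> 0 \<longleftrightarrow> x \<in> {m - L..m + L}"
      using abs_le_square_iff[of "x - m" L] \<open>0 \<le> L\<close> by (auto simp: abs_le_iff)
    show "(((x - m)\<^sup>2 - L\<^sup>2) * U x) * indicator {m - L..m + L} x \<le> ((x - m)\<^sup>2 - L\<^sup>2) * u x"
    proof (cases "x \<in> {m - L..m + L}")
      case True
      then show ?thesis
        using mult_left_mono_neg[OF U[OF True]] iff by simp
    next
      case False
      then show ?thesis
        using iff nonneg[of x] by (auto simp: not_le intro!: mult_nonneg_nonneg)
    qed
  qed
  finally show ?thesis
    by (simp add: integral_quadratic)
qed

text \<open>Duality again, now with the affine function \<open>1 - p * x\<close>: its integral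
  against \<open>u\<close> is 1, and keeping only its positive part and replacing \<open>u\<close>
  by the majorant gives at most \<open>u0 * exp 1 / p\<close>. The bound is strict because the
  integral starts at \<open>- K\<close>, where the antiderivative \<open>?F\<close> is positive; the
  extremal exponential would need a whole half-line.\<close>

lemma tilt_less:
  assumes U: "\<And>x. u x \<le> u0 * exp (p * x)" and p: "0 < p" and u0: "0 < u0"
  shows "p < u0 * exp 1"
proof -
  let ?F = "\<lambda>x. u0 * ((2 / p - x) * exp (p * x))"
  have hb: "has_bochner_integral lborel (\<lambda>x. (u0 * ((1 - p * x) * exp (p * x))) * indicator {- K..1 / p} x) (?F (1 / p) - ?F (- K))"
  proof (rule has_bochner_integral_FTC_Icc_real)
    show "- K \<le> 1 / p"
      using K_pos p by (simp add: order_trans[of "-K" 0])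
    show "(?F has_real_derivative u0 * ((1 - p * x) * exp (p * x))) (at x)" for x
      using p by (auto intro!: derivative_eq_intros simp: field_simps)
  qed (auto intro!: continuous_intros)
  have "1 = (LINT x|lborel. (- p * x + 1) * u x)"
    by (rule integral_affine[symmetric])
  also have "\<dots> \<le> (LINT x|lborel. (u0 * ((1 - p * x) * exp (p * x))) * indicator {- K..1 / p} x)"
  proof (intro integral_mono)
    show "integrable lborel (\<lambda>x. (- p * x + 1) * u x)"
      by (intro integrable_mult) (auto intro!: continuous_intros)
    show "integrable lborel (\<lambda>x. (u0 * ((1 - p * x) * exp (p * x))) * indicator {- K..1 / p} x)"
      using hb by (simp add: has_bochner_integral_iff)
    fix x
    consider "x < - K" | "- K \<le> x" "x \<le> 1 / p" | "- K \<le> x" "1 / p < x" by linarith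
    then show "(- p * x + 1) * u x \<le> (u0 * ((1 - p * x) * exp (p * x))) * indicator {- K..1 / p} x"
    proof cases
      case 1
      then show ?thesis using outside[of x] by simp
    next
      case 2
      then have "0 \<le> 1 - p * x" using p by (simp add: field_simps)
      from mult_left_mono[OF U[of x] this] 2 show ?thesis by (simp add: algebra_simps)
    next
      case 3
      then have "1 - p * x < 0" using p by (simp add: field_simps)
      then show ?thesis using 3 nonneg[of x] by (simp add: mult_nonpos_nonneg)
    qed
  qed
  also have "\<dots> = ?F (1 / p) - ?F (- K)"
    using hb by (simp add: has_bochner_integral_integral_eq)
  also have "\<dots> < ?F (1 / p)"
    using K_pos p u0 by (simp add: add_pos_pos)
  also have "\<dots> = u0 * exp 1 / p"
    using p by (simp add: field_simps)
  finally show ?thesis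
    using p by (simp add: field_simps)
qed

lemma second_moment_ge_nonneg_tilt:
  assumes U: "\<And>x. u x \<le> u0 * exp (p * x)" and p: "0 \<le> p" and u0: "0 < u0"
  shows "1 \<le> 12 * u0\<^sup>2 * (LINT x|lborel. x\<^sup>2 * u x)"
proof (cases "p = 0")
  case True
  \<comment> \<open>Without tilt the optimal density is uniform: the constant \<open>u0\<close> has
    mass 1 on [-L, L].\<close>
  define L where "L = 1 / (2 * u0)"
  have "0 < L" using u0 by (simp add: L_def)
  have "u0 * (L ^ 3 / 3 - L\<^sup>2 * L) - u0 * ((-L) ^ 3 / 3 - L\<^sup>2 * (- L)) + L\<^sup>2 - 0\<^sup>2 \<le> (LINT x|lborel. x\<^sup>2 * u x)"
    using second_moment_ge[of 0 L "\<lambda>_. u0" "\<lambda>x. u0 * (x ^ 3 / 3 - L\<^sup>2 * x)"] U True \<open>0 < L\<close>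
    by (fastforce intro!: derivative_eq_intros)
  then have "12 * u0\<^sup>2 * (u0 * (L ^ 3 / 3 - L\<^sup>2 * L) - u0 * ((-L) ^ 3 / 3 - L\<^sup>2 * (- L)) + L\<^sup>2 - 0\<^sup>2) \<le> 12 * u0\<^sup>2 * (LINT x|lborel. x\<^sup>2 * u x)"
    by (intro mult_left_mono) auto
  moreover have "12 * u0\<^sup>2 * (u0 * (L ^ 3 / 3 - L\<^sup>2 * L) - u0 * ((-L) ^ 3 / 3 - L\<^sup>2 * (- L)) + L\<^sup>2 - 0\<^sup>2) = 1"
    using u0 by (simp add: L_def field_simps power2_eq_square power3_eq_cube)
  ultimately show ?thesis by simp
next
  case False
  then have p: "0 < p" using p by simp
  have "0 < p / u0" "p / u0 < exp 1"
    using p u0 tilt_less[OF U p u0] by (auto simp: field_simps)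
  then obtain z where z: "0 < z" and pz': "p / u0 = 2 * sinh z * exp (1 - z * cosh z / sinh z)"
    by (rule tilt_surjective)
  have pz: "p = u0 * (2 * sinh z * exp (1 - z * cosh z / sinh z))"
    using pz' u0 by (simp add: field_simps)
  define y where "y = z * cosh z / sinh z"
  define s where "s = sinh z"
  have s: "0 < s" using z by (simp add: s_def)
  have zc: "z * cosh z = y * s" using s by (simp add: y_def s_def)
  \<comment> \<open>With these choices \<open>u0 * exp (p * x)\<close> has mass \<open>1\<close> and mean \<open>0\<close> on \<open>[m - L, m + L]\<close>.\<close>
  define L where "L = z / p"
  define m where "m = - (y - 1) / p"
  have L: "0 < L" using z p by (simp add: L_def)
  \<comment> \<open>Antiderivative obtained by integrating by parts twice. At \<open>m - L\<close>
    and \<open>m + L\<close> the quadratic vanishes, so only its derivatives contribute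
    there.\<close>
  define F where "F = (\<lambda>x. u0 * (exp (p * x) * (((x - m)\<^sup>2 - L\<^sup>2) / p - 2 * (x - m) / p\<^sup>2 + 2 / p ^ 3)))"
  have "F (m + L) - F (m - L) + L\<^sup>2 - m\<^sup>2 \<le> (LINT x|lborel. x\<^sup>2 * u x)"
  proof (rule second_moment_ge[where U = "\<lambda>x. u0 * exp (p * x)"])
    show "(F has_real_derivative ((x - m)\<^sup>2 - L\<^sup>2) * (u0 * exp (p * x))) (at x)" for x
      unfolding F_def using p
      by (auto intro!: derivative_eq_intros) (simp add: field_simps power2_eq_square power3_eq_cube power4_eq_xxxx)
  qed (use U L in \<open>auto intro!: continuous_intros\<close>)
  moreover have "F (m + L) - F (m - L) = - (2 * (y - 1) / p\<^sup>2)"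
  proof -
    have "exp (p * (m + L)) = exp (1 - y) * exp z" "exp (p * (m - L)) = exp (1 - y) * exp (- z)"
      using p by (simp_all add: m_def L_def field_simps flip: exp_add)
    then have "F (m + L) - F (m - L) = u0 * exp (1 - y) * (exp z * (- 2 * L / p\<^sup>2 + 2 / p ^ 3) - exp (- z) * (2 * L / p\<^sup>2 + 2 / p ^ 3))"
      unfolding F_def by (simp add: algebra_simps add_divide_distrib diff_divide_distrib)
    also have "\<dots> = u0 * exp (1 - y) * (- 2 * L / p\<^sup>2 * (exp z + exp (- z)) + 2 / p ^ 3 * (exp z - exp (- z)))"
      by (simp add: algebra_simps add_divide_distrib diff_divide_distrib)
    also have "exp z + exp (- z) = 2 * cosh z" by (simp add: cosh_def)
    also have "exp z - exp (- z) = 2 * s" by (simp add: sinh_def s_def)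
    also have "u0 * exp (1 - y) * (- 2 * L / p\<^sup>2 * (2 * cosh z) + 2 / p ^ 3 * (2 * s)) = u0 * exp (1 - y) * (- 4 * (z * cosh z - s) / p ^ 3)"
      using p by (simp add: L_def field_simps power2_eq_square power3_eq_cube)
    also have "\<dots> = u0 * exp (1 - y) * (- 4 * (y * s - s) / p ^ 3)"
      unfolding zc ..
    also have "\<dots> = (u0 * (2 * s * exp (1 - y))) * (- 2 * (y - 1) / p ^ 3)"
      by (simp add: field_simps)
    also have "u0 * (2 * s * exp (1 - y)) = p"
      unfolding pz y_def s_def ..
    also have "p * (- 2 * (y - 1) / p ^ 3) = - (2 * (y - 1) / p\<^sup>2)"
    proof -
      have "p * (- 2 * q / p ^ 3) = - (2 * q / p\<^sup>2)" for q
        using p by (simp add: power2_eq_square power3_eq_cube)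
      then show ?thesis .
    qed
    finally show ?thesis .
  qed
  ultimately have "- (2 * (y - 1) / p\<^sup>2) + L\<^sup>2 - m\<^sup>2 \<le> (LINT x|lborel. x\<^sup>2 * u x)"
    by simp
  then have "p\<^sup>2 * (- (2 * (y - 1) / p\<^sup>2) + L\<^sup>2 - m\<^sup>2) \<le> p\<^sup>2 * (LINT x|lborel. x\<^sup>2 * u x)"
    by (intro mult_left_mono) auto
  moreover have "p\<^sup>2 * (- (2 * (y - 1) / p\<^sup>2) + L\<^sup>2 - m\<^sup>2) = z\<^sup>2 + 1 - y\<^sup>2"
    using p by (simp add: L_def m_def field_simps power2_eq_square)
  moreover have "s\<^sup>2 * (z\<^sup>2 + 1 - y\<^sup>2) = s\<^sup>2 - z\<^sup>2"
    using arg_cong[OF zc, of "\<lambda>x. x\<^sup>2"] cosh_square_eq[of z]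
    by (simp add: power_mult_distrib s_def algebra_simps)
  ultimately have 1: "s\<^sup>2 - z\<^sup>2 \<le> s\<^sup>2 * (p\<^sup>2 * (LINT x|lborel. x\<^sup>2 * u x))"
    using mult_left_mono[of "z\<^sup>2 + 1 - y\<^sup>2" "p\<^sup>2 * (LINT x|lborel. x\<^sup>2 * u x)" "s\<^sup>2"] by simp
  \<comment> \<open>The factor \<open>exp (2 * (y - 1))\<close> of this inequality cancels against
    its inverse in \<open>p\<^sup>2\<close>, and \<open>s ^ 4\<close> drops out. What remains is 12
    = 3 * 4, the 4 being the square of the 2 in \<open>pz\<close>.\<close>
  have "s ^ 4 \<le> 3 * exp (2 * (y - 1)) * (s\<^sup>2 - z\<^sup>2)"
    using truncated_exponential_ineq[OF z] by (simp add: s_def y_def)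
  also have "\<dots> \<le> 3 * exp (2 * (y - 1)) * (s\<^sup>2 * (p\<^sup>2 * (LINT x|lborel. x\<^sup>2 * u x)))"
    by (intro mult_left_mono 1) auto
  also have "p\<^sup>2 = 4 * u0\<^sup>2 * s\<^sup>2 * exp (- (2 * (y - 1)))"
    unfolding pz y_def[symmetric] s_def[symmetric]
    using zc s by (simp add: power_mult_distrib flip: exp_double)
  also have "3 * exp (2 * (y - 1)) * (s\<^sup>2 * (4 * u0\<^sup>2 * s\<^sup>2 * exp (- (2 * (y - 1))) * (LINT x|lborel. x\<^sup>2 * u x)))
      = s ^ 4 * (12 * u0\<^sup>2 * (LINT x|lborel. x\<^sup>2 * u x)) * (exp (2 * (y - 1)) * exp (- (2 * (y - 1))))"
    by (simp add: power4_eq_xxxx power2_eq_square)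
  finally show ?thesis
    using s by (simp flip: exp_add)
qed

lemma second_moment_ge_tilt:
  assumes U: "\<And>x. u x \<le> u0 * exp (p * x)" and u0: "0 < u0"
  shows "1 \<le> 12 * u0\<^sup>2 * (LINT x|lborel. x\<^sup>2 * u x)"
proof (cases "0 \<le> p")
  case True
  with assms show ?thesis by (intro second_moment_ge_nonneg_tilt)
next
  case False
  interpret r: centred_density "\<lambda>x. u (- x)" K by (rule reflect)
  have "1 \<le> 12 * u0\<^sup>2 * (LINT x|lborel. x\<^sup>2 * u (- x))"
    using False u0 U[of "- x" for x] by (intro r.second_moment_ge_nonneg_tilt[of u0 "- p"]) auto
  also have "(LINT x|lborel. x\<^sup>2 * u (- x)) = (LINT x|lborel. x\<^sup>2 * u x)"
    using lborel_integral_real_affine[of "-1" "\<lambda>x. x\<^sup>2 * u x" 0] by simp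
  finally show ?thesis .
qed

end

section \<open>The model density\<close>

text \<open>At the kink the difference quotient is at most
  \<open>\<bar>h\<bar> powr (\<beta> - 1)\<close>, which tends to 0 as \<open>\<beta>\<close>
  exceeds 1. The fundamental theorem of calculus thus applies across the left end of the support of
  the model, with no splitting of the interval.\<close>

lemma DERIV_max_0_powr:
  fixes \<beta> y :: real
  assumes \<beta>: "1 < \<beta>"
  shows "((\<lambda>y. max 0 y powr \<beta>) has_real_derivative \<beta> * max 0 y powr (\<beta> - 1)) (at y)"
proof -
  consider "y < 0" | "0 < y" | "y = 0" by linarith
  then show ?thesis
  proof cases
    case 1
    have "\<forall>\<^sub>F x in nhds y. x < 0"
      using 1 by (intro eventually_nhds_in_open[of "{..<0}", simplified]) auto
    then have "\<forall>\<^sub>F x in nhds y. max 0 x powr \<beta> = 0"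
      by eventually_elim simp
    from DERIV_cong_ev[OF refl this refl, of 0] show ?thesis
      using 1 by simp
  next
    case 2
    have "\<forall>\<^sub>F x in nhds y. 0 < x"
      using 2 by (intro eventually_nhds_in_open[of "{0<..}", simplified]) auto
    then have "\<forall>\<^sub>F x in nhds y. max 0 x powr \<beta> = x powr \<beta>"
      by eventually_elim simp
    from DERIV_cong_ev[OF refl this refl, of "\<beta> * y powr (\<beta> - 1)"] has_real_derivative_powr[OF 2, of \<beta>]
    show ?thesis
      using 2 by simp
  next
    case 3
    have "((\<lambda>h. \<bar>h\<bar> powr (\<beta> - 1)) \<longlongrightarrow> \<bar>0\<bar> powr (\<beta> - 1)) (at (0::real))"
      using \<beta> by (intro tendsto_intros) auto
    then have "((\<lambda>h. \<bar>h\<bar> powr (\<beta> - 1)) \<longlongrightarrow> 0) (at (0::real))"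
      by simp
    then have "((\<lambda>h. (max 0 (0 + h) powr \<beta> - max 0 0 powr \<beta>) / h) \<longlongrightarrow> 0) (at 0)"
    proof (rule Lim_null_comparison[rotated])
      show "\<forall>\<^sub>F h in at 0. norm ((max 0 (0 + h) powr \<beta> - max 0 0 powr \<beta>) / h) \<le> \<bar>h\<bar> powr (\<beta> - 1)"
        using eventually_at_ball'[OF zero_less_one]
      proof eventually_elim
        case (elim h)
        then show ?case
          by (cases "0 < h") (simp add: powr_diff, simp add: max_def)
      qed
    qed
    then show ?thesis
      using 3 by (simp add: DERIV_def)
  qed
qed

text \<open>Extracts from an almost everywhere identity an actual point, at which pointwise
  concavity arguments apply.\<close>

lemma AE_lborel_Ioo:
  fixes a b :: real
  assumes "AE x in lborel. P x" "a < b"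
  shows "\<exists>x\<in>{a<..<b}. P x"
proof (rule ccontr)
  assume no: "\<not> (\<exists>x\<in>{a<..<b}. P x)"
  from assms(1) obtain N where N: "{x \<in> space lborel. \<not> P x} \<subseteq> N" "N \<in> null_sets lborel"
    by (auto elim!: AE_E simp: null_setsI)
  then have "{a<..<b} \<subseteq> N" using no by auto
  then have "{a<..<b} \<in> null_sets lborel"
    using N(2) by (rule null_sets_subset[rotated 2]) auto
  then show False
    using assms(2) by (simp add: null_sets_def)
qed

text \<open>The value \<open>B = (\<beta> / (\<beta> + 1)) powr \<beta>\<close> gives the
  distribution function of the model; a larger \<open>B\<close> gives an upper envelope that reaches
  1 earlier.\<close>

definition model_cdf :: "real \<Rightarrow> real \<Rightarrow> real \<Rightarrow> real \<Rightarrow> real" where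
  "model_cdf \<beta> c B x = min 1 (B * max 0 (1 + c / \<beta> * x) powr \<beta>)"

locale model_parameters =
  fixes \<beta> c :: real
  assumes \<beta>: "1 < \<beta>" and c: "0 < c"
begin

text \<open>The shift \<open>e\<close> serves two integrations: \<open>e = 0\<close> leads from the
  density to the distribution function, \<open>e = 1\<close> integrates the distribution function
  itself.\<close>

lemma DERIV_model:
  assumes "0 \<le> e"
  shows "((\<lambda>x. B * max 0 (1 + c / \<beta> * x) powr (\<beta> + e)) has_real_derivative
    (B * ((\<beta> + e) * c / \<beta>)) * max 0 (1 + c / \<beta> * x) powr (\<beta> + e - 1)) (at x)"
proof -
  have "((\<lambda>x. max 0 (1 + c / \<beta> * x) powr (\<beta> + e)) has_real_derivative
      ((\<beta> + e) * max 0 (1 + c / \<beta> * x) powr (\<beta> + e - 1)) * (c / \<beta>)) (at x)"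
    using \<beta> assms
    by (intro DERIV_chain2[OF DERIV_max_0_powr]) (auto intro!: derivative_eq_intros)
  from DERIV_cmult[OF this, of B] show ?thesis by (simp add: mult_ac)
qed

lemma isCont_model: "0 < e \<Longrightarrow> isCont (\<lambda>x. B * max 0 (1 + c / \<beta> * x) powr e) x"
  by (intro continuous_intros) auto

lemma model_eq_0:
  assumes "x \<le> - \<beta> / c"
  shows "max 0 (1 + c / \<beta> * x) = 0"
  using assms \<beta> c by (simp add: field_simps)

lemma has_integral_model_Icc:
  assumes "0 \<le> e" "a \<le> b"
  shows "has_bochner_integral lborel
    (\<lambda>x. (B * ((\<beta> + e) * c / \<beta>)) * max 0 (1 + c / \<beta> * x) powr (\<beta> + e - 1) * indicator {a..b} x)
    (B * max 0 (1 + c / \<beta> * b) powr (\<beta> + e) - B * max 0 (1 + c / \<beta> * a) powr (\<beta> + e))"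
  using assms \<beta> by (intro has_bochner_integral_FTC_Icc_real DERIV_model isCont_model) auto

lemma has_integral_model_atMost:
  assumes "0 \<le> e"
  shows "has_bochner_integral lborel
    (\<lambda>x. (B * ((\<beta> + e) * c / \<beta>)) * max 0 (1 + c / \<beta> * x) powr (\<beta> + e - 1) * indicator {..b} x)
    (B * max 0 (1 + c / \<beta> * b) powr (\<beta> + e))"
proof -
  \<comment> \<open>The integrand vanishes to the left of \<open>- \<beta> / c\<close>, so the
    half-line may be cut off at or before that point.\<close>
  define a where "a = min b (- \<beta> / c)"
  have a: "a \<le> b" "a \<le> - \<beta> / c" by (auto simp: a_def)
  have eq: "max 0 (1 + c / \<beta> * x) powr (\<beta> + e - 1) * indicator {a..b} x
      = max 0 (1 + c / \<beta> * x) powr (\<beta> + e - 1) * indicator {..b} x" for x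
    using a model_eq_0[of x] by (cases "x < a") (auto simp: indicator_def)
  show ?thesis
    using has_integral_model_Icc[OF assms a(1), of B]
    unfolding mult.assoc eq model_eq_0[OF a(2)] by simp
qed

text \<open>This integral is \<open>L\<close> minus the mean. The two lower bounds on
  \<open>L\<close> ensure that [-L, L] contains the point where the function leaves 0 and the point
  where it reaches 1. For the model's own \<open>B\<close> the value is \<open>L\<close>, which says
  that the model is centred.\<close>

lemma integral_model_cdf:
  assumes B: "0 < B" and L: "\<beta> / c \<le> L" "\<beta> / c * (B powr (- 1 / \<beta>) - 1) \<le> L"
  shows "has_bochner_integral lborel (\<lambda>x. model_cdf \<beta> c B x * indicator {- L..L} x)
    (L + \<beta> / c - \<beta> / c * (\<beta> / (\<beta> + 1)) * B powr (- 1 / \<beta>))"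
proof -
  \<comment> \<open>\<open>r\<close> solves \<open>B * r powr \<beta> = 1\<close>, and
    \<open>s\<close> is the abscissa where \<open>1 + c / \<beta> * x\<close> equals
    \<open>r\<close>: there the minimum in \<open>model_cdf\<close> switches to 1.\<close>
  define r where "r = B powr (- 1 / \<beta>)"
  define s where "s = \<beta> / c * (r - 1)"
  have r: "0 < r" using B by (simp add: r_def)
  have Br: "B * r powr \<beta> = 1"
    unfolding r_def powr_powr using B \<beta> by (simp add: powr_minus)
  have s: "1 + c / \<beta> * s = r" using \<beta> c by (simp add: s_def)
  have sL: "s \<le> L" using L(2) by (simp add: s_def r_def)
  have Ls: "- L \<le> s"
  proof -
    have "- (\<beta> / c) \<le> s" using r \<beta> c by (simp add: s_def field_simps)
    with L(1) show ?thesis by linarith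
  qed
  let ?B = "B / ((\<beta> + 1) * c / \<beta>)"
  have eq: "?B * ((\<beta> + 1) * c / \<beta>) = B"
    using \<beta> c by (intro nonzero_eq_divide_eq[THEN iffD1]) auto
  have "has_bochner_integral lborel
    (\<lambda>x. B * max 0 (1 + c / \<beta> * x) powr \<beta> * indicator {- L..s} x)
    (?B * max 0 (1 + c / \<beta> * s) powr (\<beta> + 1) - ?B * max 0 (1 + c / \<beta> * (- L)) powr (\<beta> + 1))"
    using has_integral_model_Icc[of 1 "- L" s ?B] Ls unfolding eq by simp
  also have "max 0 (1 + c / \<beta> * (- L)) = 0"
    using L(1) by (intro model_eq_0) simp
  also have "?B * max 0 (1 + c / \<beta> * s) powr (\<beta> + 1) - ?B * 0 powr (\<beta> + 1) = \<beta> / c * (r / (\<beta> + 1))"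
    using Br r \<beta> c unfolding s by (simp add: powr_add field_simps)
  finally have 1: "has_bochner_integral lborel
    (\<lambda>x. B * max 0 (1 + c / \<beta> * x) powr \<beta> * indicator {- L..s} x) (\<beta> / c * (r / (\<beta> + 1)))" .
  have 2: "has_bochner_integral lborel (\<lambda>x. indicator {s<..L} x :: real) (L - s)"
    using sL has_bochner_integral_real_indicator[of "{s<..L}" lborel] by simp
  have "has_bochner_integral lborel (\<lambda>x. model_cdf \<beta> c B x * indicator {- L..L} x)
    (\<beta> / c * (r / (\<beta> + 1)) + (L - s))"
  proof (rule has_bochner_integral_cong[THEN iffD1, OF refl _ refl has_bochner_integral_add[OF 1 2]])
    fix x
    let ?y = "max 0 (1 + c / \<beta> * x)"
    have "?y \<le> r" if "x \<le> s"
    proof -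
      have "c / \<beta> * x \<le> c / \<beta> * s" using that \<beta> c by (intro mult_left_mono) auto
      then show ?thesis using s r by simp
    qed
    then have "B * ?y powr \<beta> \<le> B * r powr \<beta>" if "x \<le> s"
      using that B \<beta> by (intro mult_left_mono powr_mono2) auto
    then have le: "B * ?y powr \<beta> \<le> 1" if "x \<le> s" using that Br by simp
    have "r \<le> ?y" if "s < x"
    proof -
      have "c / \<beta> * s \<le> c / \<beta> * x" using that \<beta> c by (intro mult_left_mono) auto
      then show ?thesis using s r by simp
    qed
    then have "B * r powr \<beta> \<le> B * ?y powr \<beta>" if "s < x"
      using that B \<beta> r by (intro mult_left_mono powr_mono2) auto
    then have ge: "1 \<le> B * ?y powr \<beta>" if "s < x" using that Br by simp
    show "B * ?y powr \<beta> * indicator {- L..s} x + indicator {s<..L} x = model_cdf \<beta> c B x * indicator {- L..L} x"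
      using le ge Ls sL by (cases "x \<le> s") (auto simp: model_cdf_def indicator_def min_def)
  qed
  also have "\<beta> / c * (r / (\<beta> + 1)) + (L - s) = L + \<beta> / c - \<beta> / c * (\<beta> / (\<beta> + 1)) * r"
  proof -
    have "\<beta> / (\<beta> + 1) * r = r - r / (\<beta> + 1)"
      using \<beta> by (simp add: divide_simps) (simp add: algebra_simps)
    moreover have "a * x + (L - a * (r - 1)) = L + a - a * (r - x)" for a x
      by (simp add: algebra_simps)
    ultimately show ?thesis
      unfolding s_def mult.assoc by (simp only:)
  qed
  finally show ?thesis by (simp add: r_def)
qed

text \<open>\<open>1 + 1 / \<beta>\<close> is the value of \<open>1 + c / \<beta> * x\<close> at the
  right end point \<open>1 / c\<close>, so the identity says that the model has total mass
  1.\<close>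

lemma model_normalization: "(\<beta> / (\<beta> + 1)) powr \<beta> * (1 + 1 / \<beta>) powr \<beta> = 1"
proof -
  have "\<beta> / (\<beta> + 1) * (1 + 1 / \<beta>) = 1"
    using \<beta> by (simp add: divide_simps)
  then show ?thesis by (metis powr_mult powr_one_eq_one)
qed

lemma cdf_model_measure: "cdf (model_measure \<beta> c) x = model_cdf \<beta> c ((\<beta> / (\<beta> + 1)) powr \<beta>) x"
proof -
  let ?\<kappa> = "(\<beta> / (\<beta> + 1)) powr \<beta>"
  let ?y = "\<lambda>x. max 0 (1 + c / \<beta> * x)"
  \<comment> \<open>Merges the right end of the support with the upper limit of the distribution
    function.\<close>
  define t where "t = min x (1 / c)"
  have "emeasure (model_measure \<beta> c) {..x} = (\<integral>\<^sup>+z. ennreal (?\<kappa> * c * ?y z powr (\<beta> - 1) * indicator {..t} z) \<partial>lborel)"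
    unfolding model_measure_def
  proof (subst emeasure_density, simp, simp, intro nn_integral_cong)
    fix z
    have "0 \<le> 1 + c / \<beta> * z" if "- \<beta> / c \<le> z"
      using that \<beta> c by (simp add: field_simps)
    then show "ennreal (c * ?\<kappa> * (1 + c / \<beta> * z) powr (\<beta> - 1) * indicator {- \<beta> / c..1 / c} z) * indicator {..x} z
      = ennreal (?\<kappa> * c * ?y z powr (\<beta> - 1) * indicator {..t} z)"
      using model_eq_0[of z] by (cases "- \<beta> / c \<le> z") (auto simp: t_def indicator_def max_def mult_ac)
  qed
  also have "\<dots> = ennreal (?\<kappa> * ?y t powr \<beta>)"
  proof -
    have "has_bochner_integral lborel (\<lambda>z. ?\<kappa> * c * ?y z powr (\<beta> - 1) * indicator {..t} z) (?\<kappa> * ?y t powr \<beta>)"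
      using has_integral_model_atMost[of 0 ?\<kappa> t] \<beta> by simp
    then show ?thesis
      using c by (intro nn_integral_eq_integral[THEN trans])
        (auto simp: has_bochner_integral_iff intro!: AE_I2 mult_nonneg_nonneg)
  qed
  finally have "cdf (model_measure \<beta> c) x = ?\<kappa> * ?y t powr \<beta>"
    by (simp add: cdf_def measure_def)
  also have "\<dots> = model_cdf \<beta> c ?\<kappa> x"
  proof -
    note 1 = model_normalization
    show ?thesis
    proof (cases "x \<le> 1 / c")
      case True
      then have "?y x \<le> 1 + 1 / \<beta>"
        using \<beta> c by (simp add: field_simps)
      then have "?\<kappa> * ?y x powr \<beta> \<le> ?\<kappa> * (1 + 1 / \<beta>) powr \<beta>"
        using \<beta> by (intro mult_left_mono powr_mono2) auto
      with True 1 show ?thesis by (simp add: t_def model_cdf_def)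
    next
      case False
      then have "1 + 1 / \<beta> \<le> ?y x"
        using \<beta> c by (simp add: field_simps)
      then have "?\<kappa> * (1 + 1 / \<beta>) powr \<beta> \<le> ?\<kappa> * ?y x powr \<beta>"
        using \<beta> by (intro mult_left_mono powr_mono2) auto
      moreover have "?y (1 / c) = 1 + 1 / \<beta>" using \<beta> c by simp
      ultimately show ?thesis using False 1 by (simp add: t_def model_cdf_def)
    qed
  qed
  finally show ?thesis .
qed

end

section \<open>Stability of the Gruenbaum inequality on the line\<close>

locale concave_density = centred_density +
  fixes \<beta> :: real
  assumes \<beta>: "1 < \<beta>"
    and concave: "\<lbrakk>0 < u x; 0 < u y; 0 \<le> t; t \<le> 1\<rbrakk> \<Longrightarrow>
      (1 - t) * u x powr (1 / (\<beta> - 1)) + t * u y powr (1 / (\<beta> - 1))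
        \<le> u ((1 - t) * x + t * y) powr (1 / (\<beta> - 1))"
begin

definition g :: "real \<Rightarrow> real" where
  "g x = u x powr (1 / (\<beta> - 1))"

lemma g_nonneg: "0 \<le> g x"
  by (simp add: g_def)

lemma g_pos_iff: "0 < g x \<longleftrightarrow> 0 < u x"
  using nonneg[of x] by (auto simp: g_def)

lemma u_eq_g: "u x = g x powr (\<beta> - 1)"
  using nonneg[of x] \<beta> by (simp add: g_def powr_powr)

text \<open>Concavity with the denominator \<open>y - x\<close> cleared, so that
  \<open>x = y\<close> is covered too.\<close>

lemma g_concave:
  assumes "0 < u x" "0 < u y" "x \<le> z" "z \<le> y"
  shows "(y - z) * g x + (z - x) * g y \<le> (y - x) * g z"
proof (cases "x = y")
  case False
  define t where "t = (z - x) / (y - x)"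
  have t: "0 \<le> t" "t \<le> 1" and tz: "(y - x) * t = z - x"
    using assms False by (auto simp: t_def field_simps)
  have "(1 - t) * x + t * y = x + (y - x) * t" by (simp add: algebra_simps)
  then have z: "(1 - t) * x + t * y = z" using tz by simp
  have "(1 - t) * g x + t * g y \<le> g z"
    using concave[OF assms(1,2) t] unfolding z g_def .
  then have "(y - x) * ((1 - t) * g x + t * g y) \<le> (y - x) * g z"
    using assms by (intro mult_left_mono) auto
  also have "(y - x) * ((1 - t) * g x + t * g y) = ((y - x) - (y - x) * t) * g x + (y - x) * t * g y"
    by (simp add: algebra_simps)
  finally show ?thesis unfolding tz by simp
qed (use assms in simp)

lemma pos_between:
  assumes "0 < u x" "0 < u y" "x \<le> z" "z \<le> y"
  shows "0 < u z"
proof (cases "x = y")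
  case False
  have "0 < g x" "0 < g y" using assms by (simp_all add: g_pos_iff)
  moreover have "0 < y - z \<or> 0 < z - x" using False assms by linarith
  ultimately have "0 < (y - z) * g x + (z - x) * g y"
    using assms by (auto intro: add_pos_nonneg add_nonneg_pos)
  then have "0 < (y - x) * g z" using g_concave[OF assms] by linarith
  then show ?thesis using assms g_nonneg[of z] by (auto simp: zero_less_mult_iff g_pos_iff)
qed (use assms in auto)

text \<open>A function of constant sign with integral 0 vanishes almost everywhere, which would
  leave \<open>u\<close> without mass. The factor \<open>s\<close> is 1 or -1, to exclude either one
  of the half-lines.\<close>

lemma first_moment_changes_sign:
  assumes "\<And>x. 0 \<le> s * (x * u x)" "s \<noteq> 0"
  shows False
proof -
  have "(LINT x|lborel. s * (x * u x)) = 0"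
    by (simp add: mean_zero)
  then have "AE x in lborel. s * (x * u x) = 0"
    using integral_nonneg_eq_0_iff_AE[of lborel "\<lambda>x. s * (x * u x)"] integrable_first_moment assms(1)
    by auto
  moreover have "AE x in lborel. x \<noteq> (0::real)"
    by (rule AE_lborel_singleton)
  ultimately have "AE x in lborel. u x = 0"
    by eventually_elim (use assms(2) in auto)
  then have "(LINT x|lborel. u x) = 0"
    by (rule integral_eq_zero_AE)
  then show False using integral_u by simp
qed

lemma positive_on_left: "\<exists>x<0. 0 < u x"
proof (rule ccontr)
  assume "\<not> (\<exists>x<0. 0 < u x)"
  then have "u x = 0" if "x < 0" for x using nonneg[of x] that by force
  then have "0 \<le> 1 * (x * u x)" for x using nonneg[of x] by (cases "x < 0") auto
  from first_moment_changes_sign[OF this] show False by simp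
qed

lemma positive_on_right: "\<exists>x>0. 0 < u x"
proof (rule ccontr)
  assume "\<not> (\<exists>x>0. 0 < u x)"
  then have "u x = 0" if "0 < x" for x using nonneg[of x] that by force
  then have "0 \<le> (- 1) * (x * u x)" for x using nonneg[of x] by (cases "0 < x") (auto simp: mult_le_0_iff)
  from first_moment_changes_sign[OF this] show False by simp
qed

lemma u0_pos: "0 < u 0"
proof -
  obtain x y where "x < 0" "0 < u x" "0 < y" "0 < u y"
    using positive_on_left positive_on_right by auto
  then show ?thesis using pos_between[of x y 0] by simp
qed

lemma g0_pos: "0 < g 0"
  by (simp add: g_pos_iff u0_pos)

text \<open>By concavity every difference quotient at 0 taken to the right is at most every one
  taken to the left. The supremum of those to the right therefore works as \<open>k\<close> on both
  sides.\<close>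

lemma supporting_line: "\<exists>k. \<forall>x. 0 < u x \<longrightarrow> g x \<le> g 0 + k * x"
proof -
  define S where "S = {(g x - g 0) / x | x. 0 < x \<and> 0 < u x}"
  have slope: "(g x - g 0) / x \<le> (g y - g 0) / y" if "0 < x" "0 < u x" "y < 0" "0 < u y" for x y
    using g_concave[OF that(4,2), of 0] that by (simp add: divide_simps) (simp add: algebra_simps)
  have ne: "S \<noteq> {}" using positive_on_right by (auto simp: S_def)
  obtain y0 where y0: "y0 < 0" "0 < u y0" using positive_on_left by auto
  have bdd: "bdd_above S" using slope[OF _ _ y0] by (auto simp: S_def bdd_above_def)
  show ?thesis
  proof (intro exI[of _ "Sup S"] allI impI)
    fix x assume x: "0 < u x"
    consider "x < 0" | "x = 0" | "0 < x" by linarith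
    then show "g x \<le> g 0 + Sup S * x"
    proof cases
      case 1
      have "Sup S \<le> (g x - g 0) / x"
        using slope[OF _ _ 1 x] by (intro cSup_least ne) (auto simp: S_def)
      then show ?thesis using 1 by (simp add: field_simps)
    next
      case 3
      have "(g x - g 0) / x \<le> Sup S"
        using 3 x by (intro cSup_upper bdd) (auto simp: S_def)
      then show ?thesis using 3 by (simp add: field_simps)
    qed simp
  qed
qed

text \<open>The supporting line at 0 and \<open>1 + t \<le> exp t\<close> bound \<open>g\<close> by
  an exponential; raising it to the power \<open>\<beta> - 1\<close> gives the exponential majorant
  of \<open>u\<close>.\<close>

lemma second_moment_bound: "1 \<le> 12 * (u 0)\<^sup>2 * (LINT x|lborel. x\<^sup>2 * u x)"
proof -
  obtain k where k: "\<And>x. 0 < u x \<Longrightarrow> g x \<le> g 0 + k * x"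
    using supporting_line by auto
  have "u x \<le> u 0 * exp (((\<beta> - 1) * k / g 0) * x)" for x
  proof (cases "0 < u x")
    case True
    have "g x \<le> g 0 * (1 + k * x / g 0)"
      using k[OF True] g0_pos by (simp add: distrib_left)
    also have "\<dots> \<le> g 0 * exp (k * x / g 0)"
      using g0_pos by (intro mult_left_mono exp_ge_add_one_self) auto
    finally have "g x powr (\<beta> - 1) \<le> (g 0 * exp (k * x / g 0)) powr (\<beta> - 1)"
      using \<beta> g_nonneg[of x] by (intro powr_mono2) auto
    also have "\<dots> = g 0 powr (\<beta> - 1) * exp (k * x / g 0) powr (\<beta> - 1)"
      by (rule powr_mult)
    also have "exp (k * x / g 0) powr (\<beta> - 1) = exp (((\<beta> - 1) * k / g 0) * x)"
      by (simp add: exp_powr_real mult_ac)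
    finally have "g x powr (\<beta> - 1) \<le> g 0 powr (\<beta> - 1) * exp (((\<beta> - 1) * k / g 0) * x)" .
    then show ?thesis using u_eq_g[of x] u_eq_g[of 0] by (simp only:)
  next
    case False
    then have "u x \<le> 0" by simp
    also have "0 \<le> u 0 * exp (((\<beta> - 1) * k / g 0) * x)" using u0_pos by simp
    finally show ?thesis .
  qed
  then show ?thesis using u0_pos by (rule second_moment_ge_tilt)
qed

section \<open>Comparison with a density whose root is affine\<close>

definition R0 :: real where
  "R0 = (LINT x|lborel. u x * indicator {..0} x)"

lemma integrable_indicator: "A \<in> sets borel \<Longrightarrow> integrable lborel (\<lambda>x. u x * indicator A x)"
  using integrable_u by (intro integrable_real_mult_indicator) auto

lemma R0_pos: "0 < R0"
proof -
  have "0 \<le> R0" unfolding R0_def using nonneg by (intro integral_nonneg_AE) auto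
  moreover have False if "R0 = 0"
  proof -
    obtain a where a: "a < 0" "0 < u a" using positive_on_left by auto
    have "AE x in lborel. u x * indicator {..0} x = 0"
      using integral_nonneg_eq_0_iff_AE[OF integrable_indicator[of "{..0}"]] that nonneg
      unfolding R0_def by auto
    from AE_lborel_Ioo[OF this a(1)] obtain x where "a < x" "x < 0" "u x = 0"
      by auto
    then show False using pos_between[OF a(2) u0_pos, of x] by simp
  qed
  ultimately show ?thesis by fastforce
qed

definition c :: real where
  "c = u 0 / R0"

lemma model_rate_eq: "model_rate u = c"
  by (simp add: model_rate_def c_def R0_def set_lebesgue_integral_def mult.commute)

sublocale model_parameters \<beta> c
  by unfold_locales (use \<beta> u0_pos R0_pos in \<open>auto simp: c_def\<close>)

text \<open>The density with piecewise linear root that takes the value \<open>u 0\<close> at 0 and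
  has the mass \<open>R0\<close> of \<open>u\<close> on the negative half-line;
  \<open>c = u 0 / R0\<close> is the rate for which both hold. It is not cut off on the right, so
  \<open>V\<close>, its integral from the left, may exceed 1.\<close>

definition v :: "real \<Rightarrow> real" where
  "v x = u 0 * max 0 (1 + c / \<beta> * x) powr (\<beta> - 1)"

definition V :: "real \<Rightarrow> real" where
  "V x = R0 * max 0 (1 + c / \<beta> * x) powr \<beta>"

lemma v_eq_powr: "v x = (g 0 * max 0 (1 + c / \<beta> * x)) powr (\<beta> - 1)"
  unfolding v_def u_eq_g[of 0] using g0_pos by (simp add: powr_mult)

lemma v_nonneg: "0 \<le> v x"
  using u0_pos by (simp add: v_def)

lemma V_0: "V 0 = R0"
  by (simp add: V_def)

lemma has_integral_v: "has_bochner_integral lborel (\<lambda>x. v x * indicator {..b} x) (V b)"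
proof -
  have "R0 * (\<beta> * c / \<beta>) = u 0" using R0_pos \<beta> by (simp add: c_def)
  then show ?thesis
    using has_integral_model_atMost[of 0 R0 b] by (simp add: v_def V_def)
qed

lemma u_less_v_iff: "u x < v x \<longleftrightarrow> g x < g 0 * max 0 (1 + c / \<beta> * x)"
proof -
  have "0 \<le> g 0 * max 0 (1 + c / \<beta> * x)" using g0_pos by simp
  then show ?thesis
    using powr_less_mono2[of "\<beta> - 1" "g x" "g 0 * max 0 (1 + c / \<beta> * x)"]
      powr_mono2[of "\<beta> - 1" "g 0 * max 0 (1 + c / \<beta> * x)" "g x"] \<beta> g_nonneg[of x]
    unfolding v_eq_powr u_eq_g[of x] by linarith
qed

text \<open>\<open>u\<close> and \<open>v\<close> have equal mass on the negative half-line. There \<open>u powr (1 / (\<beta> - 1))\<close> is concave,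
  \<open>v powr (1 / (\<beta> - 1))\<close> is piecewise linear, and both agree at \<open>0\<close>, so that they cross at most once.\<close>

lemma v_le_u_left:
  assumes y: "y \<le> 0" "v y < u y" and z: "y \<le> z" "z \<le> 0"
  shows "v z \<le> u z"
proof (rule ccontr)
  assume "\<not> v z \<le> u z"
  then have gz: "g z < g 0 * max 0 (1 + c / \<beta> * z)"
    unfolding not_le u_less_v_iff .
  have uy: "0 < u y" using y(2) v_nonneg[of y] by linarith
  have gy: "g 0 * max 0 (1 + c / \<beta> * y) \<le> g y"
    using y(2) u_less_v_iff[of y] by (auto simp: not_less)
  have "0 < g z" using pos_between[OF uy u0_pos z] by (simp add: g_pos_iff)
  then have gz: "g z < g 0 * (1 + c / \<beta> * z)"
    using gz by (auto simp: max_def split: if_splits)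
  have "g 0 * (1 + c / \<beta> * y) \<le> g 0 * max 0 (1 + c / \<beta> * y)"
    using g0_pos by (intro mult_left_mono) auto
  then have "(- z) * (g 0 * (1 + c / \<beta> * y)) + (z - y) * g 0 \<le> (- z) * g y + (z - y) * g 0"
    using z gy by (intro add_right_mono mult_left_mono) auto
  also have "\<dots> \<le> (- y) * g z"
    using g_concave[OF uy u0_pos z] by simp
  finally have 1: "(- y) * (g 0 * (1 + c / \<beta> * z)) \<le> (- y) * g z"
    by (simp add: algebra_simps)
  show False
  proof (cases "y = 0")
    case True
    then show False using y by (simp add: v_def)
  next
    case False
    then show False using 1 gz y(1) by (simp add: mult_le_cancel_left)
  qed
qed

text \<open>If \<open>u\<close> exceeded \<open>v\<close> at some \<open>z > 0\<close>, concavity of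
  \<open>g\<close> across 0 would push \<open>u\<close> strictly below \<open>v\<close> wherever
  \<open>u\<close> is positive on the left, contradicting their equal masses there.\<close>

lemma u_le_v_right:
  assumes z: "0 \<le> z"
  shows "u z \<le> v z"
proof (rule ccontr)
  assume less: "\<not> u z \<le> v z"
  then have uz: "0 < u z" using v_nonneg[of z] by linarith
  have z0: "0 < z" using less z by (cases "z = 0") (auto simp: v_def)
  have "\<not> g z \<le> g 0 * max 0 (1 + c / \<beta> * z)"
  proof
    assume "g z \<le> g 0 * max 0 (1 + c / \<beta> * z)"
    then have "g z powr (\<beta> - 1) \<le> (g 0 * max 0 (1 + c / \<beta> * z)) powr (\<beta> - 1)"
      using \<beta> g_nonneg[of z] by (intro powr_mono2) auto
    then show False using less by (simp add: v_eq_powr u_eq_g[of z])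
  qed
  moreover have "g 0 * (1 + c / \<beta> * z) \<le> g 0 * max 0 (1 + c / \<beta> * z)"
    using g0_pos by (intro mult_left_mono) auto
  ultimately have gz: "g 0 * (1 + c / \<beta> * z) < g z" by linarith
  \<comment> \<open>The chord of \<open>g\<close> from \<open>y\<close> to \<open>z\<close> passes
    below \<open>g 0\<close> at 0; as its right end lies above the line of the model, its left end
    lies below it.\<close>
  have strict: "u y < v y" if y: "y < 0" "0 < u y" for y
  proof -
    have "g y < g 0 * (1 + c / \<beta> * y)"
    proof -
      have "(- y) * (g 0 * (1 + c / \<beta> * z)) < (- y) * g z"
        using gz y by (intro mult_strict_left_mono) auto
      then have "z * g y < z * g 0 - y * g 0 - (- y) * (g 0 * (1 + c / \<beta> * z))"
        using g_concave[OF y(2) uz, of 0] y z by (simp add: algebra_simps)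
      also have "\<dots> = z * (g 0 * (1 + c / \<beta> * y))" by (simp add: algebra_simps)
      finally show ?thesis using z0 by simp
    qed
    also have "\<dots> \<le> g 0 * max 0 (1 + c / \<beta> * y)"
      using g0_pos by (intro mult_left_mono) auto
    finally show ?thesis unfolding u_less_v_iff .
  qed
  have le: "u y \<le> v y" if "y \<le> 0" for y
    using strict[of y] that v_nonneg[of y] nonneg[of y]
    by (cases "y = 0") (force simp: v_def not_less)+
  have int_v: "integrable lborel (\<lambda>x. v x * indicator {..0} x)" "(LINT x|lborel. v x * indicator {..0} x) = R0"
    using has_integral_v[of 0] by (simp_all add: has_bochner_integral_iff V_0)
  have "(LINT x|lborel. v x * indicator {..0} x - u x * indicator {..0} x) = 0"
    using int_v integrable_indicator[of "{..0}"] by (simp add: R0_def)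
  then have "AE x in lborel. v x * indicator {..0} x - u x * indicator {..0} x = 0"
    using integral_nonneg_eq_0_iff_AE[of lborel "\<lambda>x. v x * indicator {..0} x - u x * indicator {..0} x"]
      int_v(1) integrable_indicator[of "{..0}"] le
    by (auto simp: indicator_def)
  moreover obtain a where a: "a < 0" "0 < u a" using positive_on_left by auto
  ultimately obtain x where "a < x" "x < 0" "v x = u x"
    using AE_lborel_Ioo[of _ a 0] by fastforce
  then show False
    using strict[of x] pos_between[OF a(2) u0_pos, of x] by simp
qed

definition R :: "real \<Rightarrow> real" where
  "R x = (LINT y|lborel. u y * indicator {..x} y)"

text \<open>If \<open>u \<le> v\<close> on the negative part of the half-line up to
  \<open>x\<close>, the inequality holds on all of it and is integrated. Otherwise \<open>x\<close>
  lies to the right of a point where \<open>u\<close> exceeds \<open>v\<close>; then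
  \<open>v \<le> u\<close> from that point to 0 and \<open>u \<le> v\<close> beyond 0, and the
  comparison is made from 0, where \<open>R\<close> and \<open>V\<close> agree.\<close>

lemma R_le_V: "R x \<le> V x"
proof (cases "\<exists>y\<le>x. y \<le> 0 \<and> v y < u y")
  case False
  have "u y \<le> v y" if "y \<le> x" for y
    using False that u_le_v_right[of y] by (cases "y \<le> 0") (auto simp: not_less)
  then have "R x \<le> (LINT y|lborel. v y * indicator {..x} y)"
    unfolding R_def using has_integral_v[of x]
    by (intro integral_mono integrable_indicator) (auto simp: indicator_def has_bochner_integral_iff)
  also have "\<dots> = V x"
    using has_integral_v[of x] by (simp add: has_bochner_integral_iff)
  finally show ?thesis .
next
  case True
  then obtain y where y: "y \<le> x" "y \<le> 0" "v y < u y" by auto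
  have sign: "(u z - v z) * (indicator {..x} z - indicator {..0} z) \<le> 0" for z
    using v_le_u_left[OF y(2,3), of z] u_le_v_right[of z] y(1,2)
    by (cases "z \<le> 0"; cases "z \<le> x") (auto simp: mult_le_0_iff)
  have "R x - R0 = (LINT z|lborel. u z * indicator {..x} z - u z * indicator {..0} z)"
    unfolding R_def R0_def using integrable_indicator by simp
  also have "\<dots> \<le> (LINT z|lborel. v z * indicator {..x} z - v z * indicator {..0} z)"
    using has_integral_v[of x] has_integral_v[of 0] integrable_indicator sign
    by (intro integral_mono Bochner_Integration.integrable_diff)
       (auto simp: has_bochner_integral_iff algebra_simps)
  also have "\<dots> = V x - V 0"
    using has_integral_v[of x] has_integral_v[of 0] by (simp add: has_bochner_integral_iff)
  finally show ?thesis by (simp add: V_0)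
qed

lemma R_nonneg: "0 \<le> R x"
  unfolding R_def using nonneg by (intro integral_nonneg_AE) auto

lemma R_le_1: "R x \<le> 1"
proof -
  have "R x \<le> (LINT y|lborel. u y)"
    unfolding R_def using nonneg
    by (intro integral_mono integrable_indicator integrable_u) (auto simp: indicator_def)
  then show ?thesis by (simp add: integral_u)
qed

lemma R_eq_0: "x < - K \<Longrightarrow> R x = 0"
  unfolding R_def using outside by (intro integral_eq_zero_AE AE_I2) (auto simp: indicator_def)

lemma R_eq_1:
  assumes "K \<le> x"
  shows "R x = 1"
proof -
  have "R x = (LINT y|lborel. u y)"
    unfolding R_def using outside assms
    by (intro Bochner_Integration.integral_cong) (auto simp: indicator_def)
  then show ?thesis by (simp add: integral_u)
qed

lemma R_mono: "x \<le> y \<Longrightarrow> R x \<le> R y"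
  unfolding R_def using nonneg
  by (intro integral_mono integrable_indicator) (auto simp: indicator_def)

lemma measurable_R [measurable]: "R \<in> borel_measurable borel"
  by (intro borel_measurable_mono monoI R_mono)

lemma ennreal_R: "ennreal (R x) = (\<integral>\<^sup>+y. ennreal (u y) * indicator {..x} y \<partial>lborel)"
proof -
  have "ennreal (R x) = (\<integral>\<^sup>+y. ennreal (u y * indicator {..x} y) \<partial>lborel)"
    unfolding R_def using nonneg
    by (intro nn_integral_eq_integral[symmetric] integrable_indicator) auto
  also have "\<dots> = (\<integral>\<^sup>+y. ennreal (u y) * indicator {..x} y \<partial>lborel)"
    by (intro nn_integral_cong) (auto simp: indicator_def)
  finally show ?thesis .
qed

lemma cdf_density: "cdf (density lborel (\<lambda>x. ennreal (u x))) x = R x"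
  using R_nonneg[of x] by (simp add: cdf_def measure_def emeasure_density flip: ennreal_R)

text \<open>By Fubini the mass at \<open>y\<close> is counted over the length \<open>L - y\<close>,
  and the mean is 0.\<close>

lemma integral_R:
  assumes L: "K \<le> L"
  shows "has_bochner_integral lborel (\<lambda>x. R x * indicator {- L..L} x) L"
proof (rule has_bochner_integral_nn_integral)
  have "(\<integral>\<^sup>+x. ennreal (R x * indicator {- L..L} x) \<partial>lborel)
    = (\<integral>\<^sup>+x. \<integral>\<^sup>+y. (if y \<le> x \<and> - L \<le> x \<and> x \<le> L then ennreal (u y) else 0) \<partial>lborel \<partial>lborel)"
  proof (intro nn_integral_cong)
    fix x
    show "ennreal (R x * indicator {- L..L} x) = (\<integral>\<^sup>+y. (if y \<le> x \<and> - L \<le> x \<and> x \<le> L then ennreal (u y) else 0) \<partial>lborel)"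
    proof (cases "x \<in> {- L..L}")
      case True
      then show ?thesis
        by (auto simp: ennreal_R indicator_def intro!: nn_integral_cong)
    qed auto
  qed
  also have "\<dots> = (\<integral>\<^sup>+y. \<integral>\<^sup>+x. (if y \<le> x \<and> - L \<le> x \<and> x \<le> L then ennreal (u y) else 0) \<partial>lborel \<partial>lborel)"
    by (rule lborel_pair.Fubini') measurable
  also have "\<dots> = (\<integral>\<^sup>+y. ennreal ((- 1 * y + L) * u y) \<partial>lborel)"
  proof (intro nn_integral_cong)
    fix y
    show "(\<integral>\<^sup>+x. (if y \<le> x \<and> - L \<le> x \<and> x \<le> L then ennreal (u y) else 0) \<partial>lborel) = ennreal ((- 1 * y + L) * u y)"
    proof (cases "y \<in> {- K..K}")
      case True
      then have "(\<integral>\<^sup>+x. (if y \<le> x \<and> - L \<le> x \<and> x \<le> L then ennreal (u y) else 0) \<partial>lborel)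
        = (\<integral>\<^sup>+x. ennreal (u y) * indicator {y..L} x \<partial>lborel)"
        using L by (intro nn_integral_cong) (auto simp: indicator_def)
      also have "\<dots> = ennreal (u y) * ennreal (L - y)"
        using True L by (simp add: nn_integral_cmult_indicator)
      also have "\<dots> = ennreal ((- 1 * y + L) * u y)"
        using True L nonneg[of y] by (simp add: mult.commute flip: ennreal_mult)
      finally show ?thesis .
    next
      case False
      then show ?thesis using outside[of y] by (simp cong: if_cong)
    qed
  qed
  also have "\<dots> = ennreal (LINT y|lborel. (- 1 * y + L) * u y)"
  proof (intro nn_integral_eq_integral AE_I2)
    show "integrable lborel (\<lambda>y. (- 1 * y + L) * u y)"
      by (intro integrable_mult) (auto intro!: continuous_intros)
    fix y
    show "0 \<le> (- 1 * y + L) * u y"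
      using outside[of y] nonneg[of y] L by (cases "y \<in> {- K..K}") auto
  qed
  finally show "(\<integral>\<^sup>+x. ennreal (R x * indicator {- L..L} x) \<partial>lborel) = ennreal L"
    unfolding integral_affine .
  show "0 \<le> L" using L K_pos by simp
qed (use R_nonneg in auto)

section \<open>The distance between the distribution functions\<close>

lemma model_cdf_mono: "B \<le> B' \<Longrightarrow> model_cdf \<beta> c B x \<le> model_cdf \<beta> c B' x"
  unfolding model_cdf_def by (intro min.mono mult_right_mono) auto

lemma R_le_model_cdf: "R0 \<le> B \<Longrightarrow> R x \<le> model_cdf \<beta> c B x"
  using R_le_V[of x] R_le_1[of x] mult_right_mono[of R0 B "max 0 (1 + c / \<beta> * x) powr \<beta>"]
  by (simp add: model_cdf_def V_def)

abbreviation \<kappa> :: real where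
  "\<kappa> \<equiv> (\<beta> / (\<beta> + 1)) powr \<beta>"

lemma \<kappa>_powr: "\<kappa> powr (- 1 / \<beta>) = (\<beta> + 1) / \<beta>"
  using \<beta> by (simp add: powr_powr powr_minus)

text \<open>Both distributions are centred, so the integral of \<open>R - F\<close> vanishes and the integral of
  \<open>\<bar>R - F\<bar>\<close> is twice that of the positive part of \<open>R - F\<close>, which the tangent bound controls.\<close>

lemma cdf_distance_le_tangent:
  assumes A: "1 \<le> A" "R0 \<le> A * \<kappa>"
  shows "(\<integral>\<^sup>+x. ennreal \<bar>R x - model_cdf \<beta> c \<kappa> x\<bar> \<partial>lborel) \<le> ennreal (2 * (\<beta> / c * (1 - A powr (- 1 / \<beta>))))"
proof -
  define F where "F = model_cdf \<beta> c \<kappa>"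
  define G where "G = model_cdf \<beta> c (A * \<kappa>)"
  \<comment> \<open>Wide enough for both laws: \<open>R\<close> and \<open>F\<close> are 0 to the
    left of \<open>- L\<close> and 1 from \<open>L\<close> on, so outside [-L, L] they
    agree.\<close>
  define L where "L = max K (\<beta> / c)"
  have \<kappa>: "0 < \<kappa>" using \<beta> by simp
  have AK: "(A * \<kappa>) powr (- 1 / \<beta>) = A powr (- 1 / \<beta>) * ((\<beta> + 1) / \<beta>)"
    unfolding powr_mult \<kappa>_powr ..
  have e: "\<beta> / c * ((\<beta> + 1) / \<beta> - 1) = 1 / c"
    using \<beta> by (simp add: field_simps)
  have bc: "1 / c \<le> \<beta> / c" "0 < \<beta> / c" using \<beta> c by (simp_all add: divide_right_mono)
  have L: "K \<le> L" "\<beta> / c \<le> L" "0 < L" using K_pos by (auto simp: L_def)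
  have A1: "A powr (- 1 / \<beta>) \<le> 1"
    using powr_mono[of "- 1 / \<beta>" 0 A] A(1) \<beta> by simp
  have intF: "has_bochner_integral lborel (\<lambda>x. F x * indicator {- L..L} x) L"
  proof -
    have "\<beta> / c * (\<kappa> powr (- 1 / \<beta>) - 1) \<le> L"
      unfolding \<kappa>_powr e using bc L by linarith
    from integral_model_cdf[OF \<kappa> L(2) this]
    have "has_bochner_integral lborel (\<lambda>x. F x * indicator {- L..L} x)
      (L + \<beta> / c - \<beta> / c * (\<beta> / (\<beta> + 1)) * ((\<beta> + 1) / \<beta>))"
      unfolding \<kappa>_powr F_def .
    also have "L + \<beta> / c - \<beta> / c * (\<beta> / (\<beta> + 1)) * ((\<beta> + 1) / \<beta>) = L"
      using \<beta> by simp
    finally show ?thesis .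
  qed
  have intG: "has_bochner_integral lborel (\<lambda>x. G x * indicator {- L..L} x) (L + \<beta> / c * (1 - A powr (- 1 / \<beta>)))"
  proof -
    have "A powr (- 1 / \<beta>) * ((\<beta> + 1) / \<beta>) \<le> (\<beta> + 1) / \<beta>"
      using A1 \<beta> by (intro mult_left_le_one_le) auto
    then have "\<beta> / c * ((A * \<kappa>) powr (- 1 / \<beta>) - 1) \<le> \<beta> / c * ((\<beta> + 1) / \<beta> - 1)"
      unfolding AK using bc by (intro mult_left_mono) auto
    then have "\<beta> / c * ((A * \<kappa>) powr (- 1 / \<beta>) - 1) \<le> L"
      unfolding e using bc L by linarith
    moreover have "0 < A * \<kappa>" using A(1) \<kappa> by simp
    ultimately have "has_bochner_integral lborel (\<lambda>x. G x * indicator {- L..L} x)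
      (L + \<beta> / c - \<beta> / c * (\<beta> / (\<beta> + 1)) * (A * \<kappa>) powr (- 1 / \<beta>))"
      unfolding G_def using L(2) by (intro integral_model_cdf) auto
    also have "L + \<beta> / c - \<beta> / c * (\<beta> / (\<beta> + 1)) * (A * \<kappa>) powr (- 1 / \<beta>)
      = L + \<beta> / c - \<beta> / c * A powr (- 1 / \<beta>) * (\<beta> / (\<beta> + 1) * ((\<beta> + 1) / \<beta>))"
      unfolding AK by (simp only: mult_ac)
    also have "\<beta> / (\<beta> + 1) * ((\<beta> + 1) / \<beta>) = 1"
      using \<beta> by simp
    finally show ?thesis by (simp add: algebra_simps)
  qed
  \<comment> \<open>Inside [-L, L] this is 2 (G - F) - (R - F). It dominates the absolute value of R
    - F because \<open>G\<close> lies above both \<open>R\<close> and \<open>F\<close>, and since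
    \<open>R\<close> and \<open>F\<close> have the same integral, that of \<open>H\<close> is twice
    the integral of G - F.\<close>
  define H where "H = (\<lambda>x. 2 * (G x * indicator {- L..L} x - F x * indicator {- L..L} x)
        - (R x * indicator {- L..L} x - F x * indicator {- L..L} x))"
  have bound: "has_bochner_integral lborel H
      (2 * ((L + \<beta> / c * (1 - A powr (- 1 / \<beta>))) - L) - (L - L))"
    unfolding H_def
    by (intro has_bochner_integral_diff has_bochner_integral_mult_right intF intG integral_R L)
  have F_0: "F x = 0" if "x < - L" for x
  proof -
    have "x \<le> - \<beta> / c" using that L by simp
    then show ?thesis unfolding F_def model_cdf_def by (subst model_eq_0) auto
  qed
  have F_1: "F x = 1" if "L \<le> x" for x
  proof -
    have "1 / c \<le> x" using that L bc by linarith
    then have "1 + 1 / \<beta> \<le> max 0 (1 + c / \<beta> * x)" 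
      using \<beta> c by (simp add: field_simps)
    then have "\<kappa> * (1 + 1 / \<beta>) powr \<beta> \<le> \<kappa> * max 0 (1 + c / \<beta> * x) powr \<beta>"
      using \<beta> by (intro mult_left_mono powr_mono2) auto
    then show ?thesis
      unfolding F_def model_cdf_def model_normalization by simp
  qed
  have pt: "\<bar>R x - F x\<bar> \<le> H x" for x
  proof -
    have "R x \<le> G x" unfolding G_def by (intro R_le_model_cdf A)
    moreover have "F x \<le> G x"
      unfolding F_def G_def using A(1) \<kappa> by (intro model_cdf_mono) simp
    moreover have "R x = F x" if "x \<notin> {- L..L}"
      using that F_0[of x] F_1[of x] R_eq_0[of x] R_eq_1[of x] L by (cases "x < - L") auto
    ultimately show ?thesis unfolding H_def by (cases "x \<in> {- L..L}") auto
  qed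
  have "(\<integral>\<^sup>+x. ennreal \<bar>R x - F x\<bar> \<partial>lborel)
    \<le> (\<integral>\<^sup>+x. ennreal (H x) \<partial>lborel)"
    by (intro nn_integral_mono ennreal_leI pt)
  also have "\<dots> = ennreal (2 * ((L + \<beta> / c * (1 - A powr (- 1 / \<beta>))) - L) - (L - L))"
    using bound order_trans[OF abs_ge_zero pt]
    by (subst nn_integral_eq_integral) (auto simp: has_bochner_integral_iff)
  finally show ?thesis by (simp add: F_def)
qed

text \<open>Origin of the constant: the distance bound contributes \<open>2 * \<beta> / c\<close>,
  the variance bound replaces \<open>1 / c = R0 / u 0\<close> by R0 times sqrt 12 = 2 sqrt 3 times
  the standard deviation, and \<open>R0 \<le> A * \<kappa>\<close> leaves
  \<open>\<beta> * \<kappa>\<close>, the quotient of powers in the claim.\<close>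

lemma grunbaum_stability:
  assumes A: "1 \<le> A" "(LINT x|lborel. u x * indicator {..0} x) \<le> A * \<kappa>"
  shows "(\<integral>\<^sup>+x. ennreal \<bar>cdf (density lborel (\<lambda>x. ennreal (u x))) x - cdf (model_measure \<beta> (model_rate u)) x\<bar> \<partial>lborel)
    \<le> ennreal (4 * sqrt 3 * \<beta> powr (\<beta> + 1) / (\<beta> + 1) powr \<beta> * A * (1 - A powr (- 1 / \<beta>))
        * sqrt (LINT x|lborel. x\<^sup>2 * u x))"
proof -
  let ?\<sigma> = "sqrt (LINT x|lborel. x\<^sup>2 * u x)"
  have "sqrt 1 \<le> sqrt (12 * (u 0)\<^sup>2 * (LINT x|lborel. x\<^sup>2 * u x))"
    using second_moment_bound by (rule real_sqrt_le_mono)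
  also have "\<dots> = 2 * sqrt 3 * u 0 * ?\<sigma>"
    using u0_pos real_sqrt_mult[of 4 3] by (simp add: real_sqrt_mult)
  finally have "R0 * 1 \<le> R0 * (2 * sqrt 3 * u 0 * ?\<sigma>)"
    using R0_pos by (intro mult_left_mono) auto
  then have "1 / c \<le> R0 * (2 * sqrt 3 * ?\<sigma>)"
    using u0_pos by (simp add: c_def field_simps)
  also have "\<dots> \<le> (A * \<kappa>) * (2 * sqrt 3 * ?\<sigma>)"
    using A(2) nonneg unfolding R0_def[symmetric]
    by (intro mult_right_mono) (auto intro!: integral_nonneg_AE mult_nonneg_nonneg)
  finally have 1: "1 / c \<le> (A * \<kappa>) * (2 * sqrt 3 * ?\<sigma>)" .
  have A1: "A powr (- 1 / \<beta>) \<le> 1"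
    using powr_mono[of "- 1 / \<beta>" 0 A] A(1) \<beta> by simp
  have "2 * (\<beta> / c * (1 - A powr (- 1 / \<beta>))) = 1 / c * (2 * \<beta> * (1 - A powr (- 1 / \<beta>)))"
    by simp
  also have "\<dots> \<le> (A * \<kappa>) * (2 * sqrt 3 * ?\<sigma>) * (2 * \<beta> * (1 - A powr (- 1 / \<beta>)))"
    using A1 \<beta> by (intro mult_right_mono[OF 1]) auto
  also have "\<dots> = 4 * sqrt 3 * (\<beta> * \<kappa>) * A * (1 - A powr (- 1 / \<beta>)) * ?\<sigma>"
    by simp
  also have "\<beta> * \<kappa> = \<beta> powr (\<beta> + 1) / (\<beta> + 1) powr \<beta>"
    using \<beta> by (simp add: powr_divide powr_add)
  finally have 2: "2 * (\<beta> / c * (1 - A powr (- 1 / \<beta>)))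
    \<le> 4 * sqrt 3 * (\<beta> powr (\<beta> + 1) / (\<beta> + 1) powr \<beta>) * A * (1 - A powr (- 1 / \<beta>)) * ?\<sigma>" .
  have "(\<integral>\<^sup>+x. ennreal \<bar>R x - model_cdf \<beta> c \<kappa> x\<bar> \<partial>lborel) \<le> ennreal (2 * (\<beta> / c * (1 - A powr (- 1 / \<beta>))))"
    using A by (intro cdf_distance_le_tangent) (simp_all add: R0_def)
  also have "\<dots> \<le> ennreal (4 * sqrt 3 * \<beta> powr (\<beta> + 1) / (\<beta> + 1) powr \<beta> * A * (1 - A powr (- 1 / \<beta>)) * ?\<sigma>)"
    using 2 by (intro ennreal_leI) simp
  finally show ?thesis
    by (simp add: cdf_density model_rate_eq cdf_model_measure)
qed

end

section \<open>Transfer from the line to a needle\<close>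

lemma powr_concave_on_support_real:
  fixes w :: "real \<Rightarrow> real"
  assumes "powr_concave_on_support a w" "0 < w x" "0 < w y" "0 \<le> t" "t \<le> 1"
  shows "(1 - t) * w x powr a + t * w y powr a \<le> w ((1 - t) * x + t * y) powr a"
proof -
  let ?\<eta> = "\<lambda>t. (1 - t) * x + t * y"
  have "?\<eta> s - ?\<eta> t = (s - t) * (y - x)" for s t by (simp add: algebra_simps)
  then have "minimal_geodesic ?\<eta>"
    unfolding minimal_geodesic_def dist_real_def by (simp add: abs_mult abs_minus_commute)
  with assms(1,4,5) have "ereal (1 - t) * (if 0 < w (?\<eta> 0) then ereal (w (?\<eta> 0) powr a) else - \<infinity>)
      + ereal t * (if 0 < w (?\<eta> 1) then ereal (w (?\<eta> 1) powr a) else - \<infinity>)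
      \<le> (if 0 < w (?\<eta> t) then ereal (w (?\<eta> t) powr a) else - \<infinity>)"
    unfolding powr_concave_on_support_def geodesically_concave_def by fastforce
  \<comment> \<open>Both end values are finite, so the value on the right cannot be
    \<open>-\<infinity>\<close>.\<close>
  then show ?thesis
    using assms(2,3) by (auto split: if_splits)
qed

lemma scale_measure_density:
  assumes "w \<in> borel_measurable N" "0 < M" "\<And>x. 0 \<le> w x"
  shows "scale_measure (1 / ennreal M) (density N (\<lambda>x. ennreal (w x))) = density N (\<lambda>x. ennreal (w x / M))"
proof (rule measure_eqI)
  fix A assume "A \<in> sets (scale_measure (1 / ennreal M) (density N (\<lambda>x. ennreal (w x))))"
  then have A: "A \<in> sets N" by simp
  have "ennreal (w x / M) = 1 / ennreal M * ennreal (w x)" for x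
    using assms by (simp add: divide_ennreal[symmetric] divide_ennreal_def mult_ac)
  then have "emeasure (density N (\<lambda>x. ennreal (w x / M))) A = (\<integral>\<^sup>+x. 1 / ennreal M * (ennreal (w x) * indicator A x) \<partial>N)"
    using A assms(1) by (simp add: emeasure_density mult_ac)
  also have "\<dots> = 1 / ennreal M * (\<integral>\<^sup>+x. ennreal (w x) * indicator A x \<partial>N)"
    using A assms(1) by (intro nn_integral_cmult) auto
  also have "\<dots> = emeasure (scale_measure (1 / ennreal M) (density N (\<lambda>x. ennreal (w x)))) A"
    using A assms(1) by (simp add: emeasure_density)
  finally show "emeasure (scale_measure (1 / ennreal M) (density N (\<lambda>x. ennreal (w x)))) A
    = emeasure (density N (\<lambda>x. ennreal (w x / M))) A" ..
qed simp

text \<open>Dividing \<open>w\<close> by the mass of the needle preserves the concavity of its root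
  and leaves the rate \<open>model_rate\<close> unchanged, since numerator and denominator scale
  alike. All integrals over the needle become integrals against \<open>w\<close> through the image
  measure.\<close>

lemma needle_stability:
  fixes \<nu> :: "'a::topological_space measure" and b :: "'a \<Rightarrow> real" and w :: "real \<Rightarrow> real"
  assumes sets_\<nu>: "sets \<nu> = sets borel" and S: "S \<in> sets borel" and conc: "AE x in \<nu>. x \<in> S"
    and pos: "0 < measure \<nu> S"
    and b: "b \<in> borel_measurable borel" and bounded: "\<And>x. x \<in> S \<Longrightarrow> \<bar>b x\<bar> \<le> K"
    and w: "w \<in> borel_measurable borel" "\<And>x. 0 \<le> w x" "\<And>x. x \<notin> b ` S \<Longrightarrow> w x = 0"
    and image: "distr \<nu> borel b = density lborel (\<lambda>x. ennreal (w x))"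
    and concave: "powr_concave_on_support (1 / (\<beta> - 1)) w" and \<beta>: "1 < \<beta>"
    and centred: "(LINT x|\<nu>. b x) = 0"
    and A: "1 \<le> A" "measure \<nu> (S \<inter> {x. b x \<le> 0}) \<le> A * (\<beta> / (\<beta> + 1)) powr \<beta> * measure \<nu> S"
  shows "(\<integral>\<^sup>+x. ennreal \<bar>cdf (normalized_image b \<nu> S) x - cdf (model_measure \<beta> (model_rate w)) x\<bar> \<partial>lborel)
    \<le> ennreal (4 * sqrt 3 * \<beta> powr (\<beta> + 1) / (\<beta> + 1) powr \<beta> * A * (1 - A powr (- 1 / \<beta>))
        * sqrt (1 / measure \<nu> S * (LINT x:S|\<nu>. (b x)\<^sup>2)))"
proof -
  define M where "M = measure \<nu> S"
  have M: "0 < M" using pos by (simp add: M_def)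
  have b\<nu> [measurable]: "b \<in> measurable \<nu> borel" using b sets_\<nu> by (simp cong: measurable_cong_sets)
  note [measurable] = w(1)
  have space_\<nu>: "space \<nu> = UNIV" using sets_eq_imp_space_eq[OF sets_\<nu>] by simp
  have em: "emeasure \<nu> S = ennreal M"
    using pos unfolding M_def by (simp add: measure_def emeasure_eq_ennreal_measure enn2real_positive_iff)
  have pull: "(LINT x|\<nu>. f (b x)) = (LINT x|lborel. w x * f x)" if "f \<in> borel_measurable borel" for f :: "real \<Rightarrow> real"
  proof -
    have "(LINT x|\<nu>. f (b x)) = (LINT x|distr \<nu> borel b. f x)"
      using that by (intro integral_distr[symmetric]) auto
    also have "\<dots> = (LINT x|lborel. w x * f x)"
      unfolding image using that w by (subst integral_density) auto
    finally show ?thesis .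
  qed
  have on_S: "emeasure \<nu> (S \<inter> B) = emeasure \<nu> B" if "B \<in> sets borel" for B
    using that S sets_\<nu> conc by (intro emeasure_eq_AE) auto
  have lower: "emeasure \<nu> (b -` B) = (\<integral>\<^sup>+x. ennreal (w x) * indicator B x \<partial>lborel)" if "B \<in> sets borel" for B
  proof -
    have "emeasure \<nu> (b -` B) = emeasure (distr \<nu> borel b) B"
      using that by (simp add: emeasure_distr space_\<nu>)
    then show ?thesis unfolding image using that by (simp add: emeasure_density)
  qed
  have mass: "(\<integral>\<^sup>+x. ennreal (w x) \<partial>lborel) = ennreal M"
    using lower[of UNIV] on_S[of UNIV] em by simp
  have int_w: "integrable lborel w"
    using mass w by (intro integrableI_nonneg) auto
  have LINT_w: "(LINT x|lborel. w x) = M"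
    using mass w M by (subst integral_eq_nn_integral) auto
  have out: "w x = 0" if "x \<notin> {- K..K}" for x
    using that bounded w(3)[of x] by force
  interpret concave_density "\<lambda>x. w x / M" K \<beta>
  proof
    show "(LINT x|lborel. x * (w x / M)) = 0"
      using pull[of "\<lambda>x. x"] centred by (simp add: mult.commute)
    fix x y t :: real
    assume h: "0 < w x / M" "0 < w y / M" "0 \<le> t" "t \<le> 1"
    have "(1 - t) * w x powr (1 / (\<beta> - 1)) + t * w y powr (1 / (\<beta> - 1)) \<le> w ((1 - t) * x + t * y) powr (1 / (\<beta> - 1))"
      using h M by (intro powr_concave_on_support_real concave) (auto simp: zero_less_divide_iff)
    then have "((1 - t) * w x powr (1 / (\<beta> - 1)) + t * w y powr (1 / (\<beta> - 1))) / M powr (1 / (\<beta> - 1))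
        \<le> w ((1 - t) * x + t * y) powr (1 / (\<beta> - 1)) / M powr (1 / (\<beta> - 1))"
      by (intro divide_right_mono) auto
    then show "(1 - t) * (w x / M) powr (1 / (\<beta> - 1)) + t * (w y / M) powr (1 / (\<beta> - 1))
        \<le> (w ((1 - t) * x + t * y) / M) powr (1 / (\<beta> - 1))"
      by (simp add: powr_divide add_divide_distrib)
  qed (use w M out \<beta> int_w LINT_w in auto)
  have half: "(LINT x|lborel. w x / M * indicator {..0} x) \<le> A * (\<beta> / (\<beta> + 1)) powr \<beta>"
  proof -
    have "{x. b x \<le> 0} = b -` {..0}" by auto
    moreover have "b -` {..0} \<in> sets borel" using measurable_sets[OF b, of "{..0}"] by simp
    ultimately have "measure \<nu> (S \<inter> {x. b x \<le> 0}) = enn2real (\<integral>\<^sup>+x. ennreal (w x) * indicator {..0} x \<partial>lborel)"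
      using on_S[of "b -` {..0}"] lower[of "{..0}"] by (simp add: measure_def)
    also have "\<dots> = (LINT x|lborel. w x * indicator {..0} x)"
      using w by (subst integral_eq_nn_integral) (auto intro!: arg_cong[where f = enn2real] nn_integral_cong simp: indicator_def)
    finally have "(LINT x|lborel. w x * indicator {..0} x) \<le> A * (\<beta> / (\<beta> + 1)) powr \<beta> * M"
      using A(2) by (simp add: M_def)
    then show ?thesis using M by (simp add: field_simps)
  qed
  have "normalized_image b \<nu> S = density lborel (\<lambda>x. ennreal (w x / M))"
    unfolding normalized_image_def image em using M w by (intro scale_measure_density) auto
  moreover have "model_rate (\<lambda>x. w x / M) = model_rate w"
    using M by (simp add: model_rate_def set_lebesgue_integral_def)
  moreover have "(LINT x|lborel. x\<^sup>2 * (w x / M)) = 1 / M * (LINT x:S|\<nu>. (b x)\<^sup>2)"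
  proof -
    have "(LINT x:S|\<nu>. (b x)\<^sup>2) = (LINT x|\<nu>. (b x)\<^sup>2)"
      unfolding set_lebesgue_integral_def using conc S sets_\<nu> by (intro integral_cong_AE) auto
    then show ?thesis using pull[of "\<lambda>x. x\<^sup>2"] by (simp add: mult.commute)
  qed
  ultimately show ?thesis
    using grunbaum_stability[OF A(1) half] by (simp only: M_def[symmetric])
qed

section \<open>Localization\<close>

text \<open>The limit in the definition exists: along the line
  \<open>t - dist x (\<gamma> t)\<close> is nondecreasing and bounded by
  \<open>dist x (\<gamma> 0)\<close>, both by the triangle inequality.\<close>

lemma busemann_tendsto:
  assumes "straight_line \<gamma>"
  shows "((\<lambda>t. t - dist x (\<gamma> t)) \<longlongrightarrow> busemann \<gamma> x) at_top"
proof -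
  let ?h = "\<lambda>t. t - dist x (\<gamma> t)"
  have line: "dist (\<gamma> s) (\<gamma> t) = \<bar>s - t\<bar>" for s t
    using assms by (simp add: straight_line_def)
  have mono: "?h s \<le> ?h t" if "s \<le> t" for s t
    using dist_triangle[of x "\<gamma> t" "\<gamma> s"] line[of s t] that by simp
  have bound: "?h t \<le> dist x (\<gamma> 0)" for t
    using dist_triangle3[of "\<gamma> 0" "\<gamma> t" x] line[of 0 t] by (simp add: dist_commute)
  have bdd: "bdd_above (range ?h)"
    using bound by (auto simp: bdd_above_def)
  have "(?h \<longlongrightarrow> Sup (range ?h)) at_top"
  proof (rule increasing_tendsto)
    show "\<forall>\<^sub>F t in at_top. ?h t \<le> Sup (range ?h)"
      using bdd by (auto intro!: always_eventually cSup_upper)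
    fix y assume "y < Sup (range ?h)"
    then obtain s where "y < ?h s"
      using less_cSup_iff[OF _ bdd] by auto
    then show "\<forall>\<^sub>F t in at_top. y < ?h t"
      using mono[of s] by (intro eventually_at_top_linorderI[of s]) (meson less_le_trans)
  qed
  then show ?thesis
    unfolding busemann_def by (simp add: tendsto_Lim)
qed

lemma busemann_diff_le:
  assumes "straight_line \<gamma>"
  shows "busemann \<gamma> x - busemann \<gamma> y \<le> dist x y"
proof (rule tendsto_upperbound)
  show "((\<lambda>t. (t - dist x (\<gamma> t)) - (t - dist y (\<gamma> t))) \<longlongrightarrow> busemann \<gamma> x - busemann \<gamma> y) at_top"
    by (intro tendsto_diff busemann_tendsto assms)
  show "\<forall>\<^sub>F t in at_top. (t - dist x (\<gamma> t)) - (t - dist y (\<gamma> t)) \<le> dist x y"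
    using dist_triangle[of y "\<gamma> t" x for t] by (intro always_eventually) (auto simp: dist_commute algebra_simps)
qed simp

lemma busemann_lipschitz:
  assumes "straight_line \<gamma>"
  shows "\<bar>busemann \<gamma> x - busemann \<gamma> y\<bar> \<le> dist x y"
  using busemann_diff_le[OF assms, of x y] busemann_diff_le[OF assms, of y x] by (simp add: dist_commute)

lemma continuous_busemann:
  assumes "straight_line \<gamma>"
  shows "continuous_on UNIV (busemann \<gamma>)"
proof (rule lipschitz_on_continuous_on)
  show "1-lipschitz_on UNIV (busemann \<gamma>)"
    using busemann_lipschitz[OF assms] by (intro lipschitz_onI) (auto simp: dist_real_def)
qed

text \<open>Makes needles Borel sets and the Busemann function bounded on them, which yields
  densities of bounded support on the line.\<close>

lemma compact_minimal_geodesic: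
  assumes "minimal_geodesic \<eta>"
  shows "compact (\<eta> ` {0..1})"
proof (rule compact_continuous_image)
  have "(dist (\<eta> 0) (\<eta> 1))-lipschitz_on {0..1} \<eta>"
  proof (rule lipschitz_onI)
    fix s t :: real
    assume "s \<in> {0..1}" "t \<in> {0..1}"
    then have "dist (\<eta> s) (\<eta> t) = \<bar>s - t\<bar> * dist (\<eta> 0) (\<eta> 1)"
      using assms unfolding minimal_geodesic_def by blast
    then show "dist (\<eta> s) (\<eta> t) \<le> dist (\<eta> 0) (\<eta> 1) * dist s t"
      unfolding dist_real_def by (simp only: mult.commute)
  qed simp
  then show "continuous_on {0..1} \<eta>"
    by (rule lipschitz_on_continuous_on)
qed simp

lemma closed_measure_support: "closed (measure_support \<nu>)"
proof -
  have "- measure_support \<nu> = \<Union> {U. open U \<and> emeasure \<nu> U = 0}"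
    by (auto simp: measure_support_def zero_less_iff_neq_zero)
  then show ?thesis
    unfolding closed_def by auto
qed

text \<open>The complement of the support is a union of open null sets; by the Lindelof property
  countably many of them suffice.\<close>

lemma AE_measure_support:
  fixes \<nu> :: "'a::second_countable_topology measure"
  assumes "sets \<nu> = sets borel"
  shows "AE x in \<nu>. x \<in> measure_support \<nu>"
proof -
  let ?F = "{U. open U \<and> emeasure \<nu> U = 0}"
  obtain F' where F': "F' \<subseteq> ?F" "countable F'" "\<Union>F' = \<Union>?F"
    using Lindelof[of ?F] by auto
  have "\<Union>F' \<in> null_sets \<nu>"
    using F' assms by (intro null_sets_UN'[of F' id, simplified]) (auto simp: null_sets_def)
  then show ?thesis
    unfolding F'(3) by (rule AE_I') (auto simp: measure_support_def zero_less_iff_neq_zero)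
qed

lemma set_integral_density_indicator:
  assumes "sets M = sets borel" "\<rho> \<in> borel_measurable borel" "\<And>x. 0 \<le> \<rho> x" "A \<in> sets borel" "B \<in> sets borel"
  shows "(LINT x:A|M. \<rho> x * indicator B x) = measure (weighted \<rho> M) (A \<inter> B)"
proof -
  have [measurable]: "\<rho> \<in> borel_measurable M" "A \<in> sets M" "B \<in> sets M"
    using assms by (simp_all cong: measurable_cong_sets)
  have "(LINT x:A|M. \<rho> x * indicator B x) = enn2real (\<integral>\<^sup>+x. ennreal (indicator A x * (\<rho> x * indicator B x)) \<partial>M)"
    unfolding set_lebesgue_integral_def using assms(3) by (subst integral_eq_nn_integral) auto
  also have "(\<integral>\<^sup>+x. ennreal (indicator A x * (\<rho> x * indicator B x)) \<partial>M) = emeasure (weighted \<rho> M) (A \<inter> B)"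
    by (subst emeasure_density) (auto intro!: nn_integral_cong simp: indicator_def)
  finally show ?thesis by (simp add: measure_def)
qed

text \<open>Integrating the inequality that holds off \<open>Q\<close> gives (1 + \<delta>) s (1 -
  I) \<le> s, where I is the integral of \<open>a\<close> over \<open>Q\<close>; now
  \<open>s\<close> cancels.\<close>

lemma markov_selection:
  fixes a l :: "'q \<Rightarrow> real"
  assumes a: "integrable M a" "(LINT q|M. a q) = 1" and l: "integrable M l" "(LINT q|M. l q) \<le> s"
    and Q: "Q \<in> sets M" and out: "AE q in M. q \<notin> Q \<longrightarrow> (1 + \<delta>) * s * a q \<le> l q"
    and l_nonneg: "AE q in M. 0 \<le> l q" and s: "0 < s" and \<delta>: "0 < \<delta>"
  shows "\<delta> / (1 + \<delta>) \<le> (LINT q|M. a q * indicator Q q)"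
proof -
  have int: "integrable M (\<lambda>q. a q * indicator Q q)"
    using a(1) Q by (rule integrable_real_mult_indicator[rotated])
  have "(LINT q|M. (1 + \<delta>) * s * (a q - a q * indicator Q q)) \<le> (LINT q|M. l q)"
  proof (rule integral_mono_AE)
    show "AE q in M. (1 + \<delta>) * s * (a q - a q * indicator Q q) \<le> l q"
      using out l_nonneg by eventually_elim (auto simp: indicator_def)
  qed (use a(1) int l(1) in simp_all)
  then have "(1 + \<delta>) * s * (1 - (LINT q|M. a q * indicator Q q)) \<le> s"
    using a int l(2) by simp
  then have "s * ((1 + \<delta>) * (1 - (LINT q|M. a q * indicator Q q))) \<le> s * 1"
    by (simp only: mult_ac)
  then have "(1 + \<delta>) * (1 - (LINT q|M. a q * indicator Q q)) \<le> 1"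
    unfolding mult_le_cancel_left_pos[OF s] .
  then show ?thesis
    using \<delta> by (simp add: field_simps)
qed

section \<open>Masses of needles and of their unions\<close>

lemma localizationD:
  assumes "localization m \<rho> \<gamma> N \<beta> Z \<qq> X mq w"
  shows "\<forall>A\<in>sets \<qq>. (\<Union>q\<in>A. X q) \<in> sets (completion m)"
    and "\<forall>q\<in>space \<qq>. \<exists>\<eta>. minimal_geodesic \<eta> \<and> X q = \<eta> ` {0..1}"
    and "\<forall>q\<in>space \<qq>. sets (mq q) = sets borel \<and> prob_space (mq q) \<and> (AE x in mq q. x \<in> X q)"
    and "\<forall>\<phi>. integrable m \<phi> \<and> L1_support m \<phi> \<subseteq> measure_support (weighted \<rho> m) \<longrightarrow>
      (AE q in \<qq>. set_integrable (mq q) (X q) \<phi>) \<and>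
      integrable \<qq> (\<lambda>q. LINT x:X q|mq q. \<phi> x) \<and>
      (LINT x:measure_support (weighted \<rho> m)|m. \<phi> x) = (LINT q|\<qq>. (LINT x:X q|mq q. \<phi> x))"
    and "AE q in \<qq>. CD0_space N (X q) (mq q) \<and> (LINT x:X q|mq q. busemann \<gamma> x * \<rho> x) = 0"
    and "AE q in \<qq>. 0 < emeasure (weighted \<rho> (mq q)) (X q) \<longrightarrow>
      inj_on (busemann \<gamma>) (X q) \<and>
      w q \<in> borel_measurable borel \<and> (\<forall>x. 0 \<le> w q x) \<and> (\<forall>x. x \<notin> busemann \<gamma> ` X q \<longrightarrow> w q x = 0) \<and>
      distr (weighted \<rho> (mq q)) borel (busemann \<gamma>) = density lborel (\<lambda>x. ennreal (w q x)) \<and>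
      powr_concave_on_support (1 / (\<beta> - 1)) (w q)"
  using assms unfolding localization_def Let_def by - (elim conjE, assumption)+

lemma localization_needle:
  assumes loc: "localization m \<rho> \<gamma> N \<beta> Z \<qq> X mq w" and q: "q \<in> space \<qq>"
  shows "compact (X q)" "sets (mq q) = sets borel" "AE x in mq q. x \<in> X q"
proof -
  obtain \<eta> where "minimal_geodesic \<eta>" "X q = \<eta> ` {0..1}"
    using localizationD(2)[OF loc] q by blast
  then show "compact (X q)"
    using compact_minimal_geodesic by metis
  show "sets (mq q) = sets borel" "AE x in mq q. x \<in> X q"
    using localizationD(3)[OF loc] q by blast+
qed

text \<open>The localization is tested on \<open>\<rho> * indicator B\<close>. Its support lies in
  that of \<open>weighted \<rho> m\<close>, which dominates the measure it defines; and as the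
  latter measure is concentrated on its support, restricting to \<open>\<Omega>\<close> loses no
  mass.\<close>

lemma localization_disintegration:
  fixes m :: "'a::polish_space measure"
  assumes loc: "localization m \<rho> \<gamma> N \<beta> Z \<qq> X mq w"
    and \<rho>: "\<rho> \<in> borel_measurable borel" "\<And>x. 0 \<le> \<rho> x"
    and m: "sets m = sets borel" and fin: "finite_measure (weighted \<rho> m)" and B: "B \<in> sets borel"
  shows "integrable \<qq> (\<lambda>q. measure (weighted \<rho> (mq q)) (X q \<inter> B))" (is ?int)
    and "(LINT q|\<qq>. measure (weighted \<rho> (mq q)) (X q \<inter> B)) = measure (weighted \<rho> m) B" (is ?eq)
proof -
  define \<phi> where "\<phi> = (\<lambda>x. \<rho> x * indicator B x)"
  define \<Omega> where "\<Omega> = measure_support (weighted \<rho> m)"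
  have [measurable]: "\<rho> \<in> borel_measurable m" "B \<in> sets m"
    using \<rho> m B by (simp_all cong: measurable_cong_sets)
  have "emeasure (weighted \<rho> m) (space m) < \<infinity>"
    using finite_measure.emeasure_finite[OF fin, of "space m"] by (simp add: less_top)
  then have "integrable m \<rho>"
    using \<rho>(2) by (intro integrableI_nonneg) (auto simp: emeasure_density cong: nn_integral_cong)
  then have "integrable m \<phi>"
    unfolding \<phi>_def by (intro integrable_real_mult_indicator) auto
  moreover have "L1_support m \<phi> \<subseteq> \<Omega>"
  proof -
    have "emeasure (density m (\<lambda>x. ennreal \<bar>\<phi> x\<bar>)) U \<le> emeasure (weighted \<rho> m) U" if "open U" for U
    proof -
      have [measurable]: "U \<in> sets m" using that m by simp
      show ?thesis
        using \<rho>(2) by (simp add: emeasure_density \<phi>_def)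
          (auto intro!: nn_integral_mono simp: indicator_def)
    qed
    then show ?thesis
      unfolding L1_support_def \<Omega>_def measure_support_def by (auto intro: less_le_trans)
  qed
  ultimately have dis: "integrable \<qq> (\<lambda>q. LINT x:X q|mq q. \<phi> x)"
    "(LINT x:\<Omega>|m. \<phi> x) = (LINT q|\<qq>. (LINT x:X q|mq q. \<phi> x))"
    using localizationD(4)[OF loc] unfolding \<Omega>_def by blast+
  have needle: "(LINT x:X q|mq q. \<phi> x) = measure (weighted \<rho> (mq q)) (X q \<inter> B)" if "q \<in> space \<qq>" for q
    unfolding \<phi>_def using localization_needle[OF loc that] \<rho> B
    by (intro set_integral_density_indicator) (auto intro: borel_closed compact_imp_closed)
  show ?int
    using dis(1) by (simp add: needle cong: Bochner_Integration.integrable_cong)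
  have \<Omega>: "\<Omega> \<in> sets borel"
    unfolding \<Omega>_def by (intro borel_closed closed_measure_support)
  have "(LINT q|\<qq>. measure (weighted \<rho> (mq q)) (X q \<inter> B)) = (LINT x:\<Omega>|m. \<phi> x)"
    unfolding dis(2) by (intro Bochner_Integration.integral_cong) (auto simp: needle)
  also have "\<dots> = measure (weighted \<rho> m) (\<Omega> \<inter> B)"
    unfolding \<phi>_def using m \<rho> \<Omega> B by (intro set_integral_density_indicator)
  also have "\<dots> = measure (weighted \<rho> m) B"
  proof (rule measure_eq_AE)
    have "AE x in weighted \<rho> m. x \<in> \<Omega>"
      unfolding \<Omega>_def by (rule AE_measure_support) (simp add: m)
    then show "AE x in weighted \<rho> m. (x \<in> \<Omega> \<inter> B) = (x \<in> B)"
      by eventually_elim simp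
  qed (use m \<Omega> B in auto)
  finally show ?eq .
qed

text \<open>The union is measurable only for the completion, whereas the disintegration takes Borel
  sets. It is therefore applied to \<open>S \<union> N'\<close>, a Borel set containing the union
  and exceeding it by a null set of \<open>m\<close>, hence of
  \<open>weighted \<rho> m\<close>.\<close>

lemma localization_measure_union:
  fixes m :: "'a::polish_space measure"
  assumes loc: "localization m \<rho> \<gamma> N \<beta> Z \<qq> X mq w"
    and \<rho>: "\<rho> \<in> borel_measurable borel" "\<And>x. 0 \<le> \<rho> x"
    and m: "sets m = sets borel" and fin: "finite_measure (weighted \<rho> m)" and Q: "Q \<in> sets \<qq>"
  shows "(LINT q|\<qq>. measure (weighted \<rho> (mq q)) (X q) * indicator Q q)
    \<le> measure (completion (weighted \<rho> m)) (\<Union>q\<in>Q. X q)"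
proof -
  let ?\<mu> = "weighted \<rho> m"
  interpret finite_measure ?\<mu> by (rule fin)
  have "(\<Union>q\<in>Q. X q) \<in> sets (completion m)"
    using localizationD(1)[OF loc] Q by blast
  then obtain S N N' where U: "(\<Union>q\<in>Q. X q) = S \<union> N" "N \<subseteq> N'" "N' \<in> null_sets m" "S \<in> sets m"
    by (rule sets_completionE)
  have "\<rho> \<in> borel_measurable m" using \<rho> m by (simp cong: measurable_cong_sets)
  then have "N' \<in> null_sets ?\<mu>"
    using U(3) absolutely_continuousI_density[of "\<lambda>x. ennreal (\<rho> x)" m]
    by (auto simp: absolutely_continuous_def)
  then have N': "N' \<in> null_sets ?\<mu>" "emeasure ?\<mu> N' = 0" by auto
  have meas: "(\<Union>q\<in>Q. X q) \<in> sets (completion ?\<mu>)"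
    unfolding U(1) using U N' by (intro sets_completionI[of _ S N N']) auto
  have B: "S \<union> N' \<in> sets borel"
    using U m by auto
  have "(LINT q|\<qq>. measure (weighted \<rho> (mq q)) (X q) * indicator Q q)
    \<le> (LINT q|\<qq>. measure (weighted \<rho> (mq q)) (X q \<inter> (S \<union> N')))"
  proof (rule integral_mono)
    show "integrable \<qq> (\<lambda>q. measure (weighted \<rho> (mq q)) (X q) * indicator Q q)"
      using localization_disintegration(1)[OF loc \<rho> m fin, of UNIV] Q
      by (intro integrable_real_mult_indicator) auto
    show "integrable \<qq> (\<lambda>q. measure (weighted \<rho> (mq q)) (X q \<inter> (S \<union> N')))"
      by (rule localization_disintegration(1)[OF loc \<rho> m fin B])
    fix q
    show "measure (weighted \<rho> (mq q)) (X q) * indicator Q q \<le> measure (weighted \<rho> (mq q)) (X q \<inter> (S \<union> N'))"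
    proof (cases "q \<in> Q")
      case True
      then have "X q \<subseteq> S \<union> N'" using U(1,2) by blast
      then show ?thesis using True by (simp add: Int_absorb2)
    qed simp
  qed
  also have "\<dots> = measure ?\<mu> (S \<union> N')"
    by (rule localization_disintegration(2)[OF loc \<rho> m fin B])
  also have "\<dots> \<le> measure (completion ?\<mu>) (\<Union>q\<in>Q. X q)"
  proof -
    have "emeasure ?\<mu> (S \<union> N') = emeasure ?\<mu> S"
      using U(4) N' by (intro emeasure_Un_null_set) auto
    also have "\<dots> = emeasure (completion ?\<mu>) S"
      using U(4) by simp
    also have "\<dots> \<le> emeasure (completion ?\<mu>) (\<Union>q\<in>Q. X q)"
      using U(1) meas by (intro emeasure_mono) auto
    finally show ?thesis
      unfolding measure_def using meas
      by (intro enn2real_mono) (simp_all add: emeasure_completion less_top[symmetric])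
  qed
  finally show ?thesis .
qed

section \<open>Choice of the needles and stability on each of them\<close>

theorem proposition6p4:
  fixes m \<mu> :: "'a::polish_space measure"
    and \<rho> :: "'a \<Rightarrow> real"
    and N \<beta> \<epsilon> :: real
    and x\<^sub>0 :: 'a
    and \<gamma> :: "real \<Rightarrow> 'a"
    and Z :: "'a set"
    and \<qq> :: "'q measure"
    and X :: "'q \<Rightarrow> 'a set"
    and mq :: "'q \<Rightarrow> 'a measure"
    and w :: "'q \<Rightarrow> real \<Rightarrow> real"
  assumes N: "1 < N"
    and RCD: "RCD0_space N m"
    and \<rho>_measurable: "\<rho> \<in> borel_measurable borel"
    and \<rho>_nonneg: "\<forall>x. 0 \<le> \<rho> x"
    and \<mu>: "\<mu> = weighted \<rho> m"
    and \<mu>_P1: "\<mu> \<in> prob_moment 1 UNIV"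
    and \<beta>: "N < \<beta>"
    and \<rho>_concave: "powr_concave_on_support (1 / (\<beta> - N)) \<rho>"
    and x\<^sub>0: "barycenter \<mu> x\<^sub>0"
    and \<gamma>: "straight_line \<gamma>"
    and \<gamma>_x\<^sub>0: "busemann \<gamma> x\<^sub>0 = 0"
    and loc: "localization m \<rho> \<gamma> N \<beta> Z \<qq> X mq w"
    and \<epsilon>: "0 < \<epsilon>"
    and almost_equality:
      "measure \<mu> {x. busemann \<gamma> x \<le> 0} \<le> (1 + \<epsilon>) * (\<beta> / (\<beta> + 1)) powr \<beta>"
  shows "\<forall>\<delta>>0. \<exists>Q'\<subseteq>space \<qq>.
    (\<forall>q\<in>Q'. 0 < measure (weighted \<rho> (mq q)) (X q)) \<and>
    \<delta> / (1 + \<delta>) \<le> measure (completion \<mu>) (\<Union>q\<in>Q'. X q) \<and>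
    (\<forall>q\<in>Q'.
      let \<epsilon>' = \<epsilon> + \<delta> + \<epsilon> * \<delta>;
          b = busemann \<gamma>;
          \<mu>\<^sub>q = weighted \<rho> (mq q);
          c\<^sub>q = model_rate (w q);
          R\<^sub>q = cdf (normalized_image b \<mu>\<^sub>q (X q));
          F\<^sub>q = cdf (model_measure \<beta> c\<^sub>q)
      in (\<integral>\<^sup>+x. ennreal \<bar>R\<^sub>q x - F\<^sub>q x\<bar> \<partial>lborel)
         \<le> ennreal (4 * sqrt 3 * \<beta> powr (\<beta> + 1) / (\<beta> + 1) powr \<beta> *
             (1 + \<epsilon>') * (1 - (1 + \<epsilon>') powr (- 1 / \<beta>)) *
             sqrt (1 / measure \<mu>\<^sub>q (X q) * (LINT x:X q|\<mu>\<^sub>q. (b x)\<^sup>2))))"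
proof (intro allI impI)
  fix \<delta> :: real
  assume \<delta>: "0 < \<delta>"
  let ?b = "busemann \<gamma>" and ?\<nu> = "\<lambda>q. weighted \<rho> (mq q)"
  define \<epsilon>' where "\<epsilon>' = \<epsilon> + \<delta> + \<epsilon> * \<delta>"
  define s where "s = (1 + \<epsilon>) * (\<beta> / (\<beta> + 1)) powr \<beta>"
  have \<epsilon>': "1 + \<epsilon>' = (1 + \<delta>) * (1 + \<epsilon>)" by (simp add: \<epsilon>'_def algebra_simps)
  have "0 < \<epsilon>'" using \<delta> \<epsilon> by (simp add: \<epsilon>'_def add_pos_pos)
  have s: "0 < s" using \<epsilon> \<beta> N by (simp add: s_def)
  have m: "sets m = sets borel"
    using RCD by (simp add: RCD0_space_def CD0_space_def metric_measure_space_def)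
  have prob: "prob_space (weighted \<rho> m)"
    using \<mu>_P1 by (simp add: prob_moment_def \<mu>)
  then have fin: "finite_measure (weighted \<rho> m)"
    by (simp add: prob_space_def)
  have \<rho>: "\<rho> \<in> borel_measurable borel" "\<And>x. 0 \<le> \<rho> x"
    using \<rho>_measurable \<rho>_nonneg by auto
  have b: "?b \<in> borel_measurable borel"
    by (intro borel_measurable_continuous_onI continuous_busemann \<gamma>)
  have half: "{x. ?b x \<le> 0} \<in> sets borel"
    using b by measurable
  note disintegration = localization_disintegration[OF loc \<rho> m fin]
  let ?a = "\<lambda>q. measure (?\<nu> q) (X q)" and ?l = "\<lambda>q. measure (?\<nu> q) (X q \<inter> {x. ?b x \<le> 0})"
  define good where "good q \<longleftrightarrow> (LINT x:X q|mq q. ?b x * \<rho> x) = 0 \<and>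
    (0 < emeasure (?\<nu> q) (X q) \<longrightarrow>
      w q \<in> borel_measurable borel \<and> (\<forall>x. 0 \<le> w q x) \<and> (\<forall>x. x \<notin> ?b ` X q \<longrightarrow> w q x = 0) \<and>
      distr (?\<nu> q) borel ?b = density lborel (\<lambda>x. ennreal (w q x)) \<and>
      powr_concave_on_support (1 / (\<beta> - 1)) (w q))" for q
  have "AE q in \<qq>. good q"
    using localizationD(5,6)[OF loc]
    by eventually_elim (auto simp: good_def)
  then obtain E where E: "{q \<in> space \<qq>. \<not> good q} \<subseteq> E" "emeasure \<qq> E = 0" "E \<in> sets \<qq>"
    by (rule AE_E)
  \<comment> \<open>The measurable null set \<open>E\<close> is removed, not the possibly
    nonmeasurable set of needles that are not \<open>good\<close>. This keeps \<open>Q\<close>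
    measurable and gives \<open>good\<close> at each of its points.\<close>
  define Q where "Q = {q \<in> space \<qq>. q \<notin> E \<and> 0 < ?a q \<and> ?l q \<le> (1 + \<delta>) * s * ?a q}"
  have [measurable]: "?a \<in> borel_measurable \<qq>" "?l \<in> borel_measurable \<qq>" "E \<in> sets \<qq>"
    using disintegration(1)[of UNIV] disintegration(1)[OF half] E(3) by auto
  have Q: "Q \<in> sets \<qq>"
    unfolding Q_def by measurable
  have "AE q in \<qq>. q \<notin> E"
    using E by (intro AE_not_in) (simp add: null_sets_def)
  \<comment> \<open>Off \<open>E\<close> a needle misses \<open>Q\<close> either by violating the
    bound on \<open>?l\<close>, or by having mass 0, in which case the claim reads
    \<open>0 \<le> ?l q\<close>.\<close>
  then have out: "AE q in \<qq>. q \<notin> Q \<longrightarrow> (1 + \<delta>) * s * ?a q \<le> ?l q"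
    using AE_space
  proof eventually_elim
    case (elim q)
    then show ?case
      using measure_nonneg[of "?\<nu> q" "X q"] by (cases "?a q = 0") (auto simp: Q_def less_le)
  qed
  have "\<delta> / (1 + \<delta>) \<le> (LINT q|\<qq>. ?a q * indicator Q q)"
  proof (rule markov_selection[OF _ _ _ _ Q out _ s \<delta>])
    show "integrable \<qq> ?a" "(LINT q|\<qq>. ?a q) = 1"
      using disintegration[of UNIV] prob_space.prob_space[OF prob] m
      by (auto dest: sets_eq_imp_space_eq)
    show "integrable \<qq> ?l" "(LINT q|\<qq>. ?l q) \<le> s"
      using disintegration[OF half] almost_equality by (simp_all add: s_def \<mu>)
  qed simp
  also have "\<dots> \<le> measure (completion \<mu>) (\<Union>q\<in>Q. X q)"
    unfolding \<mu> by (rule localization_measure_union[OF loc \<rho> m fin Q])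
  finally have mass: "\<delta> / (1 + \<delta>) \<le> measure (completion \<mu>) (\<Union>q\<in>Q. X q)" .
  have stable: "(\<integral>\<^sup>+x. ennreal \<bar>cdf (normalized_image ?b (?\<nu> q) (X q)) x - cdf (model_measure \<beta> (model_rate (w q))) x\<bar> \<partial>lborel)
      \<le> ennreal (4 * sqrt 3 * \<beta> powr (\<beta> + 1) / (\<beta> + 1) powr \<beta> *
          (1 + \<epsilon>') * (1 - (1 + \<epsilon>') powr (- 1 / \<beta>)) *
          sqrt (1 / ?a q * (LINT x:X q|?\<nu> q. (?b x)\<^sup>2)))" if q: "q \<in> Q" for q
  proof -
    have "q \<in> space \<qq>" "good q" and pos: "0 < ?a q" and le: "?l q \<le> (1 + \<delta>) * s * ?a q"
      using q E(1) by (auto simp: Q_def)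
    note needle = localization_needle[OF loc \<open>q \<in> space \<qq>\<close>]
    have Xq: "X q \<in> sets borel" using needle(1) by (intro borel_closed compact_imp_closed)
    have mq: "\<rho> \<in> borel_measurable (mq q)" "?b \<in> borel_measurable (mq q)" "X q \<in> sets (mq q)"
      using \<rho> b Xq needle(2) by (simp_all cong: measurable_cong_sets)
    have "0 < emeasure (?\<nu> q) (X q)"
      using pos by (simp add: measure_def enn2real_positive_iff)
    then have w: "w q \<in> borel_measurable borel" "\<And>x. 0 \<le> w q x" "\<And>x. x \<notin> ?b ` X q \<Longrightarrow> w q x = 0"
      "distr (?\<nu> q) borel ?b = density lborel (\<lambda>x. ennreal (w q x))"
      "powr_concave_on_support (1 / (\<beta> - 1)) (w q)" and centred: "(LINT x:X q|mq q. ?b x * \<rho> x) = 0"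
      using \<open>good q\<close> by (auto simp: good_def)
    obtain K where K: "\<And>x. x \<in> X q \<Longrightarrow> \<bar>?b x\<bar> \<le> K"
      using compact_imp_bounded[OF compact_continuous_image[OF continuous_on_subset[OF continuous_busemann[OF \<gamma>]] needle(1)]]
      unfolding bounded_iff by auto
    show ?thesis
    proof (rule needle_stability[where K = K, OF _ Xq _ pos b K w])
      show "AE x in ?\<nu> q. x \<in> X q"
        using needle(3) mq(1) by (subst AE_density) auto
      \<comment> \<open>The zero integral of \<open>?b * \<rho>\<close> against \<open>mq q\<close>
        is the mean of the Busemann function under the needle measure: this is the centring used on
        the line.\<close>
      have "(LINT x|?\<nu> q. ?b x) = (LINT x|mq q. \<rho> x * ?b x)"
        using mq \<rho>(2) by (subst integral_density) auto
      also have "\<dots> = (LINT x:X q|mq q. ?b x * \<rho> x)"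
        unfolding set_lebesgue_integral_def
      proof (rule integral_cong_AE)
        show "AE x in mq q. \<rho> x * ?b x = indicator (X q) x *\<^sub>R (?b x * \<rho> x)"
          using needle(3) by eventually_elim simp
      qed (use mq in measurable)
      finally show "(LINT x|?\<nu> q. ?b x) = 0" using centred by simp
      show "?l q \<le> (1 + \<epsilon>') * (\<beta> / (\<beta> + 1)) powr \<beta> * ?a q"
        using le by (simp add: \<epsilon>' s_def mult.assoc)
    qed (use needle(2) N \<beta> \<open>0 < \<epsilon>'\<close> in auto)
  qed
  show "\<exists>Q'\<subseteq>space \<qq>.
    (\<forall>q\<in>Q'. 0 < measure (weighted \<rho> (mq q)) (X q)) \<and>
    \<delta> / (1 + \<delta>) \<le> measure (completion \<mu>) (\<Union>q\<in>Q'. X q) \<and>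
    (\<forall>q\<in>Q'.
      let \<epsilon>' = \<epsilon> + \<delta> + \<epsilon> * \<delta>;
          b = busemann \<gamma>;
          \<mu>\<^sub>q = weighted \<rho> (mq q);
          c\<^sub>q = model_rate (w q);
          R\<^sub>q = cdf (normalized_image b \<mu>\<^sub>q (X q));
          F\<^sub>q = cdf (model_measure \<beta> c\<^sub>q)
      in (\<integral>\<^sup>+x. ennreal \<bar>R\<^sub>q x - F\<^sub>q x\<bar> \<partial>lborel)
         \<le> ennreal (4 * sqrt 3 * \<beta> powr (\<beta> + 1) / (\<beta> + 1) powr \<beta> *
             (1 + \<epsilon>') * (1 - (1 + \<epsilon>') powr (- 1 / \<beta>)) *
             sqrt (1 / measure \<mu>\<^sub>q (X q) * (LINT x:X q|\<mu>\<^sub>q. (b x)\<^sup>2))))"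
    unfolding Let_def \<epsilon>'_def[symmetric]
    using mass stable by (intro exI[of _ Q]) (auto simp: Q_def)
qed

end
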